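(* The canonical extension $\mathfrak{Ce}(\mathfrak{F})$ of an $\mathcal{L}_n$-frame $\mathfrak{F}$ is an $\mathcal{L}_n$-bounded morphic image of an ultrapower of $\mathfrak{F}$.
   Context: Let $\mathcal{L}=\{\neg,\to,1\}\cup\{\nabla_i : i\in I\}$, each $\nabla_i$ $k_i$-ary ($k_i\ge1$). Fix $n\ge1$; $\text{Ł}_n=\{0,\frac1n,\dots,1\}$ with $\neg x=1-x$, $x\to y=\min(1,1-x+y)$. Write $m\preceq n$ for $m\mid n$. An $\mathcal{L}_n$-frame is a first-order structure $\langle W,(r_m)_{m\preceq n},(R_i)_{i\in I}\rangle$ with $W\ne\emptyset$, $R_i\subseteq W^{k_i+1}$, unary predicates $r_m\subseteq W$, $r_n=W$, $r_m\cap r_q=r_{\gcd(m,q)}$, and $R_iu:=\{\mathbf{v}:(u,\mathbf{v})\in R_i\}\subseteq r_m^{k_i}$ whenever $u\in r_m$; ultrapowers are taken in this signature. An $\mathcal{L}_n$-bounded morphism $f$ satisfies $f(R_iu)=R'_if(u)$ for all $u,i$ (with $f(R_iu)=\{(f(v_1),\dots,f(v_k)):\mathbf{v}\in R_iu\}$) and $f(r_m)\subseteq r'_m$ for all $m$; an $\mathcal{L}_n$-bounded morphic image is the codomain of a surjective one. The tight complex algebra is $\mathfrak{F}_\times=\prod_{u\in W}\text{Ł}_{s_u}$, $s_u=\gcd\{m\preceq n:u\in r_m\}$, with pointwise $\neg,\to,1$ and $\nabla_i\boldsymbol\alpha(u)=\min\{\max_\ell\alpha_\ell(v_\ell):\mathbf{v}\in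 R_iu\}$ (empty min $=1$). For such an algebra $\mathcal{A}$, $\mathcal{A}^\times$ has universe the MV-homomorphisms $\mathcal{A}\to\text{Ł}_n$, $r_m$ those with values in $\text{Ł}_m$, and $(u,\mathbf{v})\in R_i$ iff for all $\mathbf{a}\in\mathcal{A}^{k_i}$, $u(\nabla_i\mathbf{a})=1$ implies $\max_\ell v_\ell(a_\ell)=1$. The canonical extension is $\mathfrak{Ce}(\mathfrak{F})=(\mathfrak{F}_\times)^\times$. *)

theory Defs
  imports Complex_Main "HOL-Library.FuncSet"
begin

text \<open>
  The language is given by an index set \<open>I\<close> of modalities and an arity function \<open>k\<close>.
  A \<open>k i\<close>-tuple is a list of length \<open>k i\<close>, and the relation of modality \<open>i\<close>, a subset of
  the product of \<open>k i + 1\<close> copies of the universe, is a set of pairs \<open>(u, vs)\<close>.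
\<close>

definition Luk :: "nat \<Rightarrow> real set" where
  "Luk n = (\<lambda>j. real j / real n) ` {0..n}"

definition tuples :: "nat \<Rightarrow> 'a set \<Rightarrow> 'a list set" where
  "tuples k A = {xs. length xs = k \<and> set xs \<subseteq> A}"


subsection \<open>Frames and bounded morphisms\<close>

text \<open>Only the values of \<open>rpred\<close> at divisors of \<open>n\<close> and of \<open>rels\<close> at elements of \<open>I\<close> matter.\<close>

record ('i, 'w) frame =
  worlds :: "'w set"
  rpred :: "nat \<Rightarrow> 'w set"
  rels :: "'i \<Rightarrow> ('w \<times> 'w list) set"

definition is_Ln_frame :: "'i set \<Rightarrow> ('i \<Rightarrow> nat) \<Rightarrow> nat \<Rightarrow> ('i, 'w) frame \<Rightarrow> bool" where
  "is_Ln_frame I k n F \<longleftrightarrow>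
     worlds F \<noteq> {} \<and>
     (\<forall>i\<in>I. rels F i \<subseteq> worlds F \<times> tuples (k i) (worlds F)) \<and>
     (\<forall>m. m dvd n \<longrightarrow> rpred F m \<subseteq> worlds F) \<and>
     rpred F n = worlds F \<and>
     (\<forall>m q. m dvd n \<longrightarrow> q dvd n \<longrightarrow> rpred F m \<inter> rpred F q = rpred F (gcd m q)) \<and>
     (\<forall>m. m dvd n \<longrightarrow>
        (\<forall>u\<in>rpred F m. \<forall>i\<in>I. rels F i `` {u} \<subseteq> tuples (k i) (rpred F m)))"

definition Ln_bounded_morphism ::
  "'i set \<Rightarrow> ('i \<Rightarrow> nat) \<Rightarrow> nat \<Rightarrow> ('i, 'w) frame \<Rightarrow> ('i, 'v) frame \<Rightarrow> ('w \<Rightarrow> 'v) \<Rightarrow> bool" where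
  "Ln_bounded_morphism I k n F F' f \<longleftrightarrow>
     is_Ln_frame I k n F \<and> is_Ln_frame I k n F' \<and>
     f \<in> worlds F \<rightarrow> worlds F' \<and>
     (\<forall>u\<in>worlds F. \<forall>i\<in>I. map f ` (rels F i `` {u}) = rels F' i `` {f u}) \<and>
     (\<forall>m. m dvd n \<longrightarrow> f ` rpred F m \<subseteq> rpred F' m)"

definition Ln_bounded_morphic_image ::
  "'i set \<Rightarrow> ('i \<Rightarrow> nat) \<Rightarrow> nat \<Rightarrow> ('i, 'v) frame \<Rightarrow> ('i, 'w) frame \<Rightarrow> bool" where
  "Ln_bounded_morphic_image I k n F' F \<longleftrightarrow>
     (\<exists>f. Ln_bounded_morphism I k n F F' f \<and> f ` worlds F = worlds F')"


subsection \<open>Ultrapowers\<close>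

definition is_ultrafilter :: "'j filter \<Rightarrow> bool" where
  "is_ultrafilter U \<longleftrightarrow>
     U \<noteq> bot \<and> (\<forall>P. eventually P U \<or> eventually (\<lambda>j. \<not> P j) U)"

definition ultra_eq :: "'j filter \<Rightarrow> 'w set \<Rightarrow> (('j \<Rightarrow> 'w) \<times> ('j \<Rightarrow> 'w)) set" where
  "ultra_eq U W =
     {(g, h). g \<in> UNIV \<rightarrow> W \<and> h \<in> UNIV \<rightarrow> W \<and> eventually (\<lambda>j. g j = h j) U}"

text \<open>The index set is the whole type \<open>'j\<close>.\<close>

definition ultrapower :: "'j filter \<Rightarrow> ('i, 'w) frame \<Rightarrow> ('i, ('j \<Rightarrow> 'w) set) frame" where
  "ultrapower U F =
     (let W = worlds F; cls = (\<lambda>g. ultra_eq U W `` {g}) in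
      \<lparr> worlds = (UNIV \<rightarrow> W) // ultra_eq U W,
        rpred = (\<lambda>m. {cls g | g. g \<in> UNIV \<rightarrow> W \<and> eventually (\<lambda>j. g j \<in> rpred F m) U}),
        rels = (\<lambda>i. {(cls g, map cls hs) | g hs.
                  g \<in> UNIV \<rightarrow> W \<and> set hs \<subseteq> (UNIV \<rightarrow> W) \<and>
                  eventually (\<lambda>j. (g j, map (\<lambda>h. h j) hs) \<in> rels F i) U}) \<rparr>)"


subsection \<open>Complex algebras and canonical extensions\<close>

record ('i, 'a) alg =
  univ :: "'a set"
  neg :: "'a \<Rightarrow> 'a"
  imp :: "'a \<Rightarrow> 'a \<Rightarrow> 'a"
  one :: "'a"
  nabla :: "'i \<Rightarrow> 'a list \<Rightarrow> 'a"

definition s_idx :: "nat \<Rightarrow> ('i, 'w) frame \<Rightarrow> 'w \<Rightarrow> nat" where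
  "s_idx n F u = Gcd {m. m dvd n \<and> u \<in> rpred F m}"

text \<open>
  Elements are functions on the worlds, made extensional (undefined outside), so that
  the universe really is the product over \<open>worlds F\<close>.
\<close>

definition tight_complex_algebra ::
  "('i \<Rightarrow> nat) \<Rightarrow> nat \<Rightarrow> ('i, 'w) frame \<Rightarrow> ('i, 'w \<Rightarrow> real) alg" where
  "tight_complex_algebra k n F =
     \<lparr> univ = (\<Pi>\<^sub>E u\<in>worlds F. Luk (s_idx n F u)),
       neg = (\<lambda>a. \<lambda>u\<in>worlds F. 1 - a u),
       imp = (\<lambda>a b. \<lambda>u\<in>worlds F. min 1 (1 - a u + b u)),
       one = (\<lambda>u\<in>worlds F. 1),
       nabla = (\<lambda>i as. \<lambda>u\<in>worlds F.
         if rels F i `` {u} = {} then 1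
         else Min {Max {(as ! l) (vs ! l) | l. l < k i} | vs. vs \<in> rels F i `` {u}}) \<rparr>"

text \<open>MV-homomorphisms into \<open>Luk n\<close>, extensional outside the universe of the algebra.\<close>

definition mv_homs :: "nat \<Rightarrow> ('i, 'a) alg \<Rightarrow> ('a \<Rightarrow> real) set" where
  "mv_homs n A =
     {h \<in> univ A \<rightarrow>\<^sub>E Luk n.
        h (one A) = 1 \<and>
        (\<forall>a\<in>univ A. h (neg A a) = 1 - h a) \<and>
        (\<forall>a\<in>univ A. \<forall>b\<in>univ A. h (imp A a b) = min 1 (1 - h a + h b))}"

definition canonical_frame ::
  "('i \<Rightarrow> nat) \<Rightarrow> nat \<Rightarrow> ('i, 'a) alg \<Rightarrow> ('i, 'a \<Rightarrow> real) frame" where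
  "canonical_frame k n A =
     \<lparr> worlds = mv_homs n A,
       rpred = (\<lambda>m. {h \<in> mv_homs n A. h ` univ A \<subseteq> Luk m}),
       rels = (\<lambda>i. {(u, vs). u \<in> mv_homs n A \<and> vs \<in> tuples (k i) (mv_homs n A) \<and>
                (\<forall>as \<in> tuples (k i) (univ A).
                   u (nabla A i as) = 1 \<longrightarrow> Max {(vs ! l) (as ! l) | l. l < k i} = 1)}) \<rparr>"

definition canonical_extension ::
  "('i \<Rightarrow> nat) \<Rightarrow> nat \<Rightarrow> ('i, 'w) frame \<Rightarrow> ('i, ('w \<Rightarrow> real) \<Rightarrow> real) frame" where
  "canonical_extension k n F = canonical_frame k n (tight_complex_algebra k n F)"

end

theory Submission
  imports Defs
begin

text \<open>
  For an ultrafilter \<open>U\<close>, a point \<open>[g]\<close> of the ultrapower is sent to the homomorphism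
  taking \<open>\<alpha>\<close> to the \<open>U\<close>-limit of \<open>\<alpha> \<circ> g\<close>. Every homomorphism \<open>h\<close> is determined by the
  ultrafilter of those \<open>B\<close> whose indicator function has \<open>h\<close>-value 1, so surjectivity and the
  back condition both ask for tuples that lie, \<open>U\<close>-almost everywhere, in every member of a
  filter base consisting of up to \<open>2^|W|\<close> boxes. An ultrafilter on the power set of \<open>W\<close>
  with this amount of saturation is built as in Kunen's construction of good ultrafilters: run
  through all saturation requirements, keeping the filter reached so far independent of a large
  family of functions. At each step either some set of the requirement can be made null at the
  cost of finitely many functions of the family, or a single function of the family is used up
  to define a solution.
\<close>

section \<open>Saturated ultrafilters\<close>

unbundle cardinal_syntax

text \<open>\<open>G\<close> indexes the functions that later stages may still spend. The case
  \<open>S = {}\<close> makes \<open>F\<close> proper.\<close>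

definition independent_mod :: "'j filter \<Rightarrow> 'a set \<Rightarrow> ('a \<Rightarrow> 'j \<Rightarrow> 'b) \<Rightarrow> bool" where
  "independent_mod F G e \<longleftrightarrow>
     (\<forall>S c. finite S \<longrightarrow> S \<subseteq> G \<longrightarrow> frequently (\<lambda>j. \<forall>a\<in>S. e a j = c a) F)"

text \<open>A saturation requirement: \<open>X j\<close> holds the candidates at \<open>j\<close>,
  and \<open>P\<close> is a filter base of constraints on them. For a proper filter no solution can
  exist once some \<open>B\<close> misses almost every \<open>X j\<close>, so that outcome also
  settles the requirement.\<close>

definition satisfies_directed :: "'j filter \<Rightarrow> ('j \<Rightarrow> 'v set) \<Rightarrow> 'v set set \<Rightarrow> bool" where
  "satisfies_directed F X P \<longleftrightarrow>
     (P \<noteq> {} \<longrightarrow> (\<forall>B\<in>P. \<forall>B'\<in>P. B \<inter> B' \<in> P) \<longrightarrow>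
       (\<exists>B\<in>P. eventually (\<lambda>j. X j \<inter> B = {}) F) \<or>
       (\<exists>h. \<forall>B\<in>P. eventually (\<lambda>j. h j \<in> X j \<inter> B) F))"

lemma satisfies_directed_mono:
  assumes "satisfies_directed F X P" "F' \<le> F"
  shows "satisfies_directed F' X P"
  using assms unfolding satisfies_directed_def by (meson filter_leD)

lemma independent_modD:
  assumes "independent_mod F G e" "finite S" "S \<subseteq> G"
  shows "frequently (\<lambda>j. \<forall>a\<in>S. e a j = c a) F"
  using assms unfolding independent_mod_def by blast

lemma independent_mod_not_bot:
  assumes "independent_mod F G e"
  shows "F \<noteq> bot"
proof
  assume "F = bot"
  then show False
    using independent_modD[OF assms, of "{}"] by (simp add: frequently_def)
qed

lemma frequently_inf_principal:
  "frequently P (inf F (principal A)) \<longleftrightarrow> frequently (\<lambda>j. j \<in> A \<and> P j) F"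
  unfolding frequently_def eventually_inf_principal by (auto elim!: eventually_mono)

text \<open>Failure of independence means that some finite pattern \<open>c\<close> on
  \<open>S\<close> almost never occurs inside \<open>A\<close>. Restricting \<open>F\<close> to this
  pattern makes \<open>A\<close> null. A pattern on finitely many members of \<open>G - S\<close>
  can be glued to \<open>c\<close>, so only \<open>S\<close> is lost.\<close>

lemma independent_mod_decide:
  assumes ind: "independent_mod F G e"
    and not: "\<not> independent_mod (inf F (principal A)) G e"
  obtains F' S where "F' \<le> F" "finite S" "independent_mod F' (G - S) e" "eventually (\<lambda>j. j \<notin> A) F'"
proof -
  obtain S c where S: "finite S" "S \<subseteq> G"
    and nf: "\<not> frequently (\<lambda>j. j \<in> A \<and> (\<forall>a\<in>S. e a j = c a)) F"
    using not unfolding independent_mod_def frequently_inf_principal by auto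
  define F' where "F' = inf F (principal {j. \<forall>a\<in>S. e a j = c a})"
  have "independent_mod F' (G - S) e"
    unfolding independent_mod_def
  proof (intro allI impI)
    fix S' c' assume S': "finite S'" "S' \<subseteq> G - S"
    let ?d = "\<lambda>a. if a \<in> S then c a else c' a"
    have "frequently (\<lambda>j. \<forall>a\<in>S \<union> S'. e a j = ?d a) F"
      using S S' by (intro independent_modD[OF ind]) auto
    then show "frequently (\<lambda>j. \<forall>a\<in>S'. e a j = c' a) F'"
      unfolding F'_def frequently_inf_principal
      by (rule frequently_elim1) (use S' in \<open>auto split: if_splits\<close>)
  qed
  moreover have "eventually (\<lambda>j. j \<notin> A) F'"
    using nf unfolding F'_def eventually_inf_principal frequently_def
    by (auto elim: eventually_mono)
  ultimately show thesis
    using that[of F' S] S by (auto simp: F'_def)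
qed

lemma independent_mod_decide_eventually:
  assumes "independent_mod F G e"
  obtains F' S where "F' \<le> F" "finite S" "independent_mod F' (G - S) e"
    "eventually (\<lambda>j. j \<in> A) F' \<or> eventually (\<lambda>j. j \<notin> A) F'"
proof (cases "independent_mod (inf F (principal A)) G e")
  case True
  then show thesis
    using that[of "inf F (principal A)" "{}"] by (simp add: eventually_inf_principal)
next
  case False
  then show thesis
    using independent_mod_decide[OF assms] that by metis
qed

text \<open>If for some \<open>B\<close> adding the set where \<open>X j\<close> meets
  \<open>B\<close> destroys independence, that set can be made null. Otherwise one function of the
  family yields a solution, because its values are themselves possible constraints.\<close>

lemma independent_mod_satisfies_directed:
  fixes e :: "'a \<Rightarrow> 'j \<Rightarrow> 'v set" and X :: "'j \<Rightarrow> 'v set"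
  assumes ind: "independent_mod F G e" and G: "G \<noteq> {}"
  obtains F' S where "F' \<le> F" "finite S" "independent_mod F' (G - S) e" "satisfies_directed F' X P"
proof (cases "P \<noteq> {} \<and> (\<forall>B\<in>P. \<forall>B'\<in>P. B \<inter> B' \<in> P)")
  case False
  then show thesis
    using that[of F "{}"] ind by (auto simp: satisfies_directed_def)
next
  case P: True
  show thesis
  proof (cases "\<exists>B\<in>P. \<not> independent_mod (inf F (principal {j. X j \<inter> B \<noteq> {}})) G e")
    case True
    then obtain B where B: "B \<in> P" "\<not> independent_mod (inf F (principal {j. X j \<inter> B \<noteq> {}})) G e"
      by blast
    obtain F' S where "F' \<le> F" "finite S" "independent_mod F' (G - S) e"
      "eventually (\<lambda>j. j \<notin> {j. X j \<inter> B \<noteq> {}}) F'"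
      using independent_mod_decide[OF ind B(2)] .
    with B that[of F' S] show thesis
      by (auto simp: satisfies_directed_def)
  next
    case False
    obtain a where a: "a \<in> G" using G by blast
    \<comment> \<open>\<open>e a j\<close> acts as a guess of the constraint to be met at
      \<open>j\<close>: wherever the guess is \<open>B\<close> and \<open>X j\<close> meets
      \<open>B\<close>, the choice \<open>h j\<close> is correct for \<open>B\<close>.\<close>
    define h where "h j = (SOME v. v \<in> X j \<inter> e a j)" for j
    define Y where "Y B = {j. h j \<in> X j \<inter> B}" for B
    define F' where "F' = (INF B\<in>P. inf F (principal (Y B)))"
    \<comment> \<open>\<open>P\<close> is closed under intersection, so these filters are directed,
      and whatever holds eventually in \<open>F'\<close> already does so for a single
      \<open>B\<close>.\<close>
    have ev: "eventually Q F' \<longleftrightarrow> (\<exists>B\<in>P. eventually Q (inf F (principal (Y B))))" for Q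
      unfolding F'_def
    proof (rule eventually_INF_base)
      fix B B' assume "B \<in> P" "B' \<in> P"
      then show "\<exists>x\<in>P. inf F (principal (Y x)) \<le> inf (inf F (principal (Y B))) (inf F (principal (Y B')))"
        using P by (intro bexI[of _ "B \<inter> B'"])
          (auto simp: le_inf_iff Y_def intro!: le_infI2)
    qed (use P in simp)
    have "independent_mod F' (G - {a}) e"
      unfolding independent_mod_def
    proof (intro allI impI)
      fix S c assume S: "finite S" "S \<subseteq> G - {a}"
      show "frequently (\<lambda>j. \<forall>b\<in>S. e b j = c b) F'"
        unfolding frequently_def ev
      proof clarify
        fix B assume B: "B \<in> P"
          and evB: "eventually (\<lambda>j. \<not> (\<forall>b\<in>S. e b j = c b)) (inf F (principal (Y B)))"
        have B_ind: "independent_mod (inf F (principal {j. X j \<inter> B \<noteq> {}})) G e"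
          using False B by blast
        \<comment> \<open>The pattern on \<open>S\<close> is extended by the value \<open>B\<close>
          at the spent function \<open>a\<close>; this causes no conflict because \<open>a\<close>
          is not in \<open>S\<close>.\<close>
        have "frequently (\<lambda>j. \<forall>b\<in>insert a S. e b j = (c(a := B)) b)
            (inf F (principal {j. X j \<inter> B \<noteq> {}}))"
          by (rule independent_modD[OF B_ind]) (use S a in auto)
        then have "frequently (\<lambda>j. j \<in> Y B \<and> (\<forall>b\<in>S. e b j = c b)) F"
          unfolding frequently_inf_principal
        proof (rule frequently_elim1)
          fix j assume *: "j \<in> {j. X j \<inter> B \<noteq> {}} \<and> (\<forall>b\<in>insert a S. e b j = (c(a := B)) b)"
          then have "\<exists>v. v \<in> X j \<inter> e a j" "e a j = B" by auto
          then have "h j \<in> X j \<inter> B"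
            unfolding h_def by (metis (no_types, lifting) someI_ex)
          moreover have "\<forall>b\<in>S. e b j = c b" using * S by auto
          ultimately show "j \<in> Y B \<and> (\<forall>b\<in>S. e b j = c b)"
            by (simp add: Y_def)
        qed
        then show False
          using evB unfolding frequently_def eventually_inf_principal by (auto elim: eventually_mono)
      qed
    qed
    moreover have "\<forall>B\<in>P. eventually (\<lambda>j. h j \<in> X j \<inter> B) F'"
    proof
      fix B assume "B \<in> P"
      then show "eventually (\<lambda>j. h j \<in> X j \<inter> B) F'"
        unfolding ev by (rule bexI[rotated]) (simp add: eventually_inf_principal Y_def)
    qed
    then have "satisfies_directed F' X P"
      unfolding satisfies_directed_def by blast
    moreover have "F' \<le> F"
      unfolding F'_def using P by (auto intro: INF_lower2)
    ultimately show thesis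
      by (intro that[of F' "{a}"]) auto
  qed
qed

text \<open>
  Engelking--Karlowicz: an index carries a finite list of points and a finite table which is looked
  up at the trace of \<open>A\<close> on that list.
\<close>

lemma independent_family:
  fixes \<sigma> :: "'j \<Rightarrow> 'a list \<times> ('a list \<times> 'b) list"
  assumes "surj \<sigma>"
  obtains e :: "'a set \<Rightarrow> 'j \<Rightarrow> 'b" where "independent_mod top UNIV e"
proof -
  define e :: "'a set \<Rightarrow> 'j \<Rightarrow> 'b" where
    "e A j = the (map_of (snd (\<sigma> j)) (filter (\<lambda>x. x \<in> A) (fst (\<sigma> j))))" for A j
  have "\<exists>j. \<forall>A\<in>S. e A j = c A" if fin: "finite S" for S c
  proof -
    have "\<exists>x. x \<in> A \<longleftrightarrow> x \<notin> B" if "A \<noteq> B" for A B :: "'a set"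
      using that by blast
    then obtain d where d: "A \<noteq> B \<Longrightarrow> d A B \<in> A \<longleftrightarrow> d A B \<notin> B" for A B :: "'a set"
      by metis
    \<comment> \<open>When \<open>A\<close> and \<open>B\<close> differ, \<open>d A B\<close> lies
      in exactly one of them. A list \<open>s\<close> of these points therefore gives the members of
      \<open>S\<close> distinct traces, and the table \<open>r\<close> has one entry per
      key.\<close>
    have "finite ((\<lambda>(A, B). d A B) ` (S \<times> S))"
      using fin by simp
    from finite_list[OF this] obtain s where s: "set s = (\<lambda>(A, B). d A B) ` (S \<times> S)" ..
    obtain l where l: "set l = S" "distinct l"
      using finite_distinct_list[OF fin] by blast
    define r where "r = map (\<lambda>A. (filter (\<lambda>x. x \<in> A) s, c A)) l"
    have sep: "A = B" if "A \<in> S" "B \<in> S" "filter (\<lambda>x. x \<in> A) s = filter (\<lambda>x. x \<in> B) s" for A B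
    proof (rule ccontr)
      assume "A \<noteq> B"
      moreover have "d A B \<in> set s" using s that by auto
      ultimately show False
        using d[of A B] arg_cong[OF that(3), of set] by auto
    qed
    have "distinct (map fst r)"
      unfolding r_def using l sep by (auto simp: distinct_map comp_def inj_on_def)
    moreover obtain j where j: "\<sigma> j = (s, r)" using assms by (metis surjD)
    ultimately have "e A j = c A" if "A \<in> S" for A
      using that l unfolding e_def by (subst map_of_eq_Some_iff[THEN iffD2, of _ _ "c A"]) (auto simp: r_def)
    then show ?thesis by blast
  qed
  then have "independent_mod top UNIV e"
    by (simp add: independent_mod_def frequently_def eventually_top)
  then show thesis by (rule that)
qed

section \<open>The transfinite construction of a saturated ultrafilter\<close>

lemma small_initial_union_not_UNIV:
  fixes M :: "'a \<Rightarrow> 'a set"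
  defines "R \<equiv> card_of (UNIV :: 'a set)"
  assumes inf: "infinite (UNIV :: 'a set)"
    and fin: "\<And>y. y \<in> underS R x \<Longrightarrow> finite (M y)" and N: "finite N"
  shows "(\<Union>y\<in>underS R x. M y) \<union> N \<noteq> UNIV"
proof (cases "finite (underS R x)")
  case True
  then have "finite ((\<Union>y\<in>underS R x. M y) \<union> N)" using fin N by blast
  then show ?thesis using inf by metis
next
  case False
  \<comment> \<open>A union of finite sets over an infinite index set is no larger than the index
    set, and a proper initial segment of a cardinal order is smaller than the whole type. Putting
    \<open>N\<close> into every term lets one bound cover both parts.\<close>
  have "|\<Union>y\<in>underS R x. M y \<union> N| \<le>o |underS R x|"
  proof (rule card_of_UNION_ordLeq_infinite[OF False])
    show "\<forall>y\<in>underS R x. |M y \<union> N| \<le>o |underS R x|"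
      using False fin N
      by (intro ballI ordLess_imp_ordLeq finite_ordLess_infinite card_of_Well_order)
        (simp_all add: Field_card_of)
  qed (rule card_of_refl[THEN ordIso_imp_ordLeq])
  also have "|underS R x| <o |UNIV :: 'a set|"
    unfolding R_def by (rule card_of_underS) (rule card_of_Card_order, simp add: Field_card_of)
  finally have "(\<Union>y\<in>underS R x. M y \<union> N) \<noteq> UNIV"
    by (metis not_ordLess_ordIso card_of_refl)
  moreover have "(\<Union>y\<in>underS R x. M y \<union> N) = (\<Union>y\<in>underS R x. M y) \<union> N"
    using False by (auto dest: infinite_imp_nonempty)
  ultimately show ?thesis by simp
qed

text \<open>Surjectivity of \<open>\<sigma>\<close> gives each single piece of a requirement a code
  in \<open>'j\<close>, hence each requirement a code that is a set of indices. Stages and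
  independent functions are then both indexed by \<open>'j set\<close>; as every stage spends only
  finitely many functions, the reserve outlasts the recursion.\<close>

lemma saturated_ultrafilter_infinite:
  fixes \<sigma> :: "'j \<Rightarrow> 'j list \<times> ('j list \<times> 'v set) list"
  assumes \<sigma>: "surj \<sigma>"
  obtains U :: "'j filter" where "is_ultrafilter U"
    "\<And>X P. satisfies_directed U (X :: 'j \<Rightarrow> 'v set) P"
proof -
  obtain e :: "'j set \<Rightarrow> 'j \<Rightarrow> 'v set" where e: "independent_mod top UNIV e"
    using independent_family[OF \<sigma>] .
  define R where "R = card_of (UNIV :: 'j set set)"
  \<comment> \<open>A set \<open>T\<close> of indices codes a requirement \<open>(X T, P T)\<close>. Stage \<open>T\<close> also decides \<open>T\<close> itself,
    which makes the limit filter an ultrafilter.\<close>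
  define X where "X T j = {v. inv \<sigma> ([j], [([], {v})]) \<in> T}" for T j
  define P where "P T = {B. inv \<sigma> ([], [([], B)]) \<in> T}" for T
  have code: "\<exists>T. X T = X' \<and> P T = P'" for X' :: "'j \<Rightarrow> 'v set" and P'
  proof -
    \<comment> \<open>The two kinds of code differ in their first component, \<open>[j]\<close>
      against \<open>[]\<close>, so \<open>X'\<close> and \<open>P'\<close> can be prescribed
      independently.\<close>
    let ?T = "{x. (\<exists>j v. \<sigma> x = ([j], [([], {v})]) \<and> v \<in> X' j) \<or> (\<exists>B\<in>P'. \<sigma> x = ([], [([], B)]))}"
    have "X ?T = X'" "P ?T = P'"
      by (auto simp: X_def P_def surj_f_inv_f[OF \<sigma>] fun_eq_iff)
    then show ?thesis by blast
  qed
  have inf: "infinite (UNIV :: 'j set set)"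
  proof -
    have "infinite (UNIV :: ('j list \<times> ('j list \<times> 'v set) list) set)"
      by (simp add: finite_prod infinite_UNIV_listI)
    then have "infinite (UNIV :: 'j set)"
      using \<sigma> by (metis finite_imageI)
    then show ?thesis
      by (simp add: Finite_Set.finite_set)
  qed
  have wf: "wf (R - Id)"
    unfolding R_def using card_of_Well_order[of "UNIV :: 'j set set"]
    by (simp add: well_order_on_def)
  have Rtrans: "trans (R - Id)" and Rtotal: "total R"
    using card_of_Well_order[of "UNIV :: 'j set set"]
    by (auto simp: R_def well_order_on_def linear_order_on_def Field_card_of
        partial_order_on_def preorder_on_def intro: trans_diff_Id)
  define below where "below T = {T'. (T', T) \<in> R - Id}" for T
  \<comment> \<open>A stage returns a filter together with the finite set of functions that it
    spends; \<open>used f T\<close> collects what was spent strictly before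
    \<open>T\<close>.\<close>
  define used where "used f T = (\<Union>T'\<in>below T. snd (f T'))" for f :: "'j set \<Rightarrow> 'j filter \<times> 'j set set" and T
  define Good where "Good f T r \<longleftrightarrow> fst r \<le> (INF T'\<in>below T. fst (f T')) \<and> finite (snd r) \<and>
      independent_mod (fst r) (- (snd r \<union> used f T)) e \<and>
      (eventually (\<lambda>j. j \<in> T) (fst r) \<or> eventually (\<lambda>j. j \<notin> T) (fst r)) \<and>
      satisfies_directed (fst r) (X T) (P T)" for f :: "'j set \<Rightarrow> 'j filter \<times> 'j set set" and T r
  \<comment> \<open>The filters decrease along \<open>R\<close>, so whatever holds eventually in
    their infimum holds at some stage. This is what carries properness and independence through
    limits.\<close>
  have INF_chain: "eventually Q (INF T\<in>D. fst (f T)) \<longleftrightarrow> (\<exists>T\<in>D. eventually Q (fst (f T)))"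
    if D: "D \<noteq> {}" "\<And>T. T \<in> D \<Longrightarrow> Good f T (f T)" for D f Q
  proof (rule eventually_INF_base[OF D(1)])
    fix A B assume AB: "A \<in> D" "B \<in> D"
    have le: "fst (f B) \<le> fst (f A)" if "(A, B) \<in> R - Id" "B \<in> D" for A B
      using D(2)[OF that(2)] that(1) by (auto simp: Good_def below_def le_INF_iff)
    consider "A = B" | "(A, B) \<in> R - Id" | "(B, A) \<in> R - Id"
      using Rtotal by (auto simp: total_on_def)
    then show "\<exists>C\<in>D. fst (f C) \<le> inf (fst (f A)) (fst (f B))"
      by cases (use AB le in \<open>auto intro: inf_greatest\<close>)
  qed
  have "\<exists>f. \<forall>T. Good f T (f T)"
  proof (rule dependent_wf_choice[OF wf])
    fix f g :: "'j set \<Rightarrow> 'j filter \<times> 'j set set" and T r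
    assume eq: "\<And>z. (z, T) \<in> R - Id \<Longrightarrow> f z = g z"
    have "used f T = used g T" "(INF T'\<in>below T. fst (f T')) = (INF T'\<in>below T. fst (g T'))"
      unfolding used_def using eq by (auto simp: below_def intro!: arg_cong[of _ _ Inf])
    then show "Good f T r = Good g T r"
      by (simp add: Good_def)
  next
    fix T and f :: "'j set \<Rightarrow> 'j filter \<times> 'j set set"
    assume IH: "\<And>T'. (T', T) \<in> R - Id \<Longrightarrow> Good f T' (f T')"
    define F where "F = (INF T'\<in>below T. fst (f T'))"
    have indF: "independent_mod F (- used f T) e"
    proof (cases "below T = {}")
      case True
      then show ?thesis using e by (simp add: F_def used_def)
    next
      case False
      have ev: "eventually Q F \<longleftrightarrow> (\<exists>T'\<in>below T. eventually Q (fst (f T')))" for Q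
        unfolding F_def by (rule INF_chain) (use False IH in \<open>auto simp: below_def\<close>)
      show ?thesis
        unfolding independent_mod_def
      proof (intro allI impI)
        fix S c assume S: "finite S" "S \<subseteq> - used f T"
        show "frequently (\<lambda>j. \<forall>a\<in>S. e a j = c a) F"
          unfolding frequently_def ev
        proof
          assume "\<exists>T'\<in>below T. eventually (\<lambda>j. \<not> (\<forall>a\<in>S. e a j = c a)) (fst (f T'))"
          then obtain T' where T': "T' \<in> below T"
            and evT': "eventually (\<lambda>j. \<not> (\<forall>a\<in>S. e a j = c a)) (fst (f T'))" by blast
          have "below T' \<subseteq> below T"
            using T' Rtrans by (auto simp: below_def dest: transD)
          then have sub: "- used f T \<subseteq> - (snd (f T') \<union> used f T')"
            using T' by (auto simp: used_def)
          have "independent_mod (fst (f T')) (- (snd (f T') \<union> used f T')) e"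
            using IH T' by (simp add: Good_def below_def)
          from independent_modD[OF this S(1) order_trans[OF S(2) sub]]
          show False using evT' by (simp add: frequently_def)
        qed
      qed
    qed
    obtain F1 S1 where 1: "F1 \<le> F" "finite S1" "independent_mod F1 (- used f T - S1) e"
      "eventually (\<lambda>j. j \<in> T) F1 \<or> eventually (\<lambda>j. j \<notin> T) F1"
      using independent_mod_decide_eventually[OF indF] .
    \<comment> \<open>Counting shows that some function is left after \<open>T\<close> has been
      decided; the requirement of this stage may need it.\<close>
    have "finite (snd (f T'))" if "T' \<in> underS R T" for T'
      using IH that by (auto simp: underS_def Good_def)
    then have "(\<Union>T'\<in>underS R T. snd (f T')) \<union> S1 \<noteq> UNIV"
      using 1(2) unfolding R_def by (intro small_initial_union_not_UNIV inf) auto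
    moreover have "underS R T = below T"
      by (auto simp: underS_def below_def)
    ultimately have ne: "- used f T - S1 \<noteq> {}"
      by (auto simp: used_def)
    obtain F2 S2 where 2: "F2 \<le> F1" "finite S2" "independent_mod F2 (- used f T - S1 - S2) e"
      "satisfies_directed F2 (X T) (P T)"
      using independent_mod_satisfies_directed[OF 1(3) ne] .
    have "Good f T (F2, S1 \<union> S2)"
      using 1 2 unfolding Good_def F_def[symmetric]
      by (auto intro: filter_leD order_trans elim: back_subst[of "\<lambda>G. independent_mod F2 G e"])
    then show "\<exists>r. Good f T r" ..
  qed
  then obtain f where f: "\<And>T. Good f T (f T)" by blast
  define U where "U = (INF T. fst (f T))"
  have ev: "eventually Q U \<longleftrightarrow> (\<exists>T. eventually Q (fst (f T)))" for Q
    unfolding U_def using f by (subst INF_chain) auto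
  have le: "U \<le> fst (f T)" for T
    unfolding U_def by (rule INF_lower) simp
  have "U \<noteq> bot"
    using f independent_mod_not_bot unfolding Good_def ev trivial_limit_def by metis
  moreover have "eventually Q U \<or> eventually (\<lambda>j. \<not> Q j) U" for Q
    using f[of "{j. Q j}"] unfolding ev Good_def by auto
  ultimately have "is_ultrafilter U"
    by (simp add: is_ultrafilter_def)
  moreover have "satisfies_directed U X' P'" for X' :: "'j \<Rightarrow> 'v set" and P'
    using code[of X' P'] f le satisfies_directed_mono unfolding Good_def by metis
  ultimately show thesis by (rule that)
qed

section \<open>Cardinal arithmetic for the coding\<close>

lemma card_of_UNIV_ordLeq_iff_surj:
  "|UNIV :: 'a set| \<le>o |UNIV :: 'b set| \<longleftrightarrow> (\<exists>f :: 'b \<Rightarrow> 'a. surj f)"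
  using card_of_ordLeq2[of "UNIV :: 'a set" "UNIV :: 'b set"] by simp

lemma card_of_list_infinite:
  assumes "infinite (UNIV :: 'a set)"
  shows "|UNIV :: 'a list set| \<le>o |UNIV :: 'a set|"
proof -
  have "|{xs :: 'a list. length xs = n}| \<le>o |UNIV :: 'a set|" for n
  proof (induction n)
    case 0
    show ?case using card_of_singl_ordLeq[of "UNIV :: 'a set" "[] :: 'a list"] by simp
  next
    case (Suc n)
    have "|{xs :: 'a list. length xs = Suc n}| \<le>o |(UNIV :: 'a set) \<times> {xs :: 'a list. length xs = n}|"
    proof (rule card_of_ordLeqI)
      show "inj_on (\<lambda>xs. (hd xs, tl xs)) {xs :: 'a list. length xs = Suc n}"
        by (rule inj_onI) (metis (mono_tags) Pair_inject length_0_conv list.expand mem_Collect_eq nat.distinct(1))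
    qed simp
    moreover have "|(UNIV :: 'a set) \<times> {xs :: 'a list. length xs = n}| \<le>o |UNIV :: 'a set|"
      using assms Suc card_of_refl[THEN ordIso_imp_ordLeq]
      by (intro card_of_Sigma_ordLeq_infinite) simp_all
    ultimately show ?case by (rule ordLeq_transitive)
  qed
  then have "|\<Union>n\<in>(UNIV :: nat set). {xs :: 'a list. length xs = n}| \<le>o |UNIV :: 'a set|"
    using assms by (intro card_of_UNION_ordLeq_infinite) (simp_all add: infinite_iff_card_of_nat)
  moreover have "(\<Union>n. {xs :: 'a list. length xs = n}) = UNIV" by auto
  ultimately show ?thesis by simp
qed

text \<open>Lists over an infinite type are no more numerous than its points, so there are no more
  sets of lists than sets of points. Products and finite lists do not enlarge an infinite cardinal
  either.\<close>

lemma surj_from_sets: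
  assumes inf: "infinite (UNIV :: 'w set)"
  obtains \<sigma> :: "'w set \<Rightarrow> 'w set list \<times> ('w set list \<times> 'w list set) list" where "surj \<sigma>"
proof -
  let ?J = "UNIV :: 'w set set"
  have J: "infinite ?J" using inf by (simp add: Finite_Set.finite_set)
  obtain q :: "'w \<Rightarrow> 'w list" where "surj q"
    using card_of_list_infinite[OF inf] unfolding card_of_UNIV_ordLeq_iff_surj ..
  then have "surj (image q)"
    using image_Pow_surj[of q UNIV UNIV] by simp
  then have "|UNIV :: 'w list set set| \<le>o |?J|"
    unfolding card_of_UNIV_ordLeq_iff_surj by (intro exI[of _ "image q"])
  moreover have L: "|UNIV :: 'w set list set| \<le>o |?J|"
    by (rule card_of_list_infinite[OF J])
  ultimately have "|(UNIV :: 'w set list set) \<times> (UNIV :: 'w list set set)| \<le>o |?J|"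
    by (intro card_of_Sigma_ordLeq_infinite[OF J] ballI)
  then obtain h :: "'w set \<Rightarrow> 'w set list \<times> 'w list set" where h: "surj h"
    unfolding UNIV_Times_UNIV card_of_UNIV_ordLeq_iff_surj ..
  have "|(UNIV :: 'w set list set) \<times> (UNIV :: 'w set list set)| \<le>o |?J|"
    by (rule card_of_Sigma_ordLeq_infinite[OF J L ballI[OF L]])
  then obtain g :: "'w set \<Rightarrow> 'w set list \<times> 'w set list" where g: "surj g"
    unfolding UNIV_Times_UNIV card_of_UNIV_ordLeq_iff_surj ..
  have "surj (map h)"
    using h lists_image[of h UNIV] by simp
  then have "surj (map_prod id (map h) \<circ> g)"
    using g by (intro comp_surj map_prod_surj) simp_all
  then show thesis by (rule that)
qed

text \<open>A directed family of subsets of a finite set has a least member, found here by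
  minimising cardinality. Either it is empty, or any of its points satisfies all constraints at
  once.\<close>

lemma satisfies_directed_principal:
  assumes "finite (X j)"
  shows "satisfies_directed (principal {j}) X P"
  unfolding satisfies_directed_def
proof (intro impI disjCI)
  assume P: "P \<noteq> {}" "\<forall>B\<in>P. \<forall>B'\<in>P. B \<inter> B' \<in> P"
    and "\<not> (\<exists>h. \<forall>B\<in>P. \<forall>\<^sub>F i in principal {j}. h i \<in> X i \<inter> B)"
  then have no: "\<not> (\<exists>v. \<forall>B\<in>P. v \<in> X j \<inter> B)"
    by (auto simp: eventually_principal)
  obtain B where B: "B \<in> P" "\<And>B'. B' \<in> P \<Longrightarrow> card (X j \<inter> B) \<le> card (X j \<inter> B')"
    using P(1) ex_has_least_nat[of "\<lambda>B. B \<in> P" _ "\<lambda>B. card (X j \<inter> B)"] by blast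
  have "X j \<inter> B \<subseteq> X j \<inter> B'" if "B' \<in> P" for B'
  proof -
    have "X j \<inter> (B \<inter> B') = X j \<inter> B"
      using assms P(2) B that by (intro card_seteq) auto
    then show ?thesis by blast
  qed
  then have "X j \<inter> B = {}" using no by blast
  then show "\<exists>B\<in>P. \<forall>\<^sub>F i in principal {j}. X i \<inter> B = {}"
    using B(1) by (auto simp: eventually_principal)
qed

text \<open>Values are lists so that whole successor tuples can be found at once. Over a finite type
  the fixed length makes every \<open>X j\<close> finite and a principal ultrafilter suffices; over
  an infinite type the coding by sets applies.\<close>

lemma saturated_ultrafilter:
  obtains U :: "'w set filter" where "is_ultrafilter U"
    "\<And>m X P. (\<And>j. X j \<subseteq> {xs :: 'w list. length xs = m}) \<Longrightarrow> satisfies_directed U X P"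
proof (cases "finite (UNIV :: 'w set)")
  case True
  have "finite (X j)" if "\<And>j :: 'w set. X j \<subseteq> {xs :: 'w list. length xs = m}" for X m j
    using that finite_lists_length_eq[OF True, of m] by (auto intro: finite_subset)
  moreover have "is_ultrafilter (principal {{} :: 'w set})"
    by (simp add: is_ultrafilter_def eventually_principal principal_eq_bot_iff)
  ultimately show thesis
    by (intro that[of "principal {{}}"] satisfies_directed_principal) (assumption, blast)
next
  case False
  obtain \<sigma> :: "'w set \<Rightarrow> 'w set list \<times> ('w set list \<times> 'w list set) list" where "surj \<sigma>"
    using surj_from_sets[OF False] .
  then show thesis
    by (rule saturated_ultrafilter_infinite) (rule that)
qed


section \<open>The tight complex algebra and its homomorphisms\<close>

lemma Luk_iff:
  assumes "m > 0"
  shows "x \<in> Luk m \<longleftrightarrow> 0 \<le> x \<and> x \<le> 1 \<and> x * real m \<in> \<int>"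
proof
  assume "x \<in> Luk m"
  then show "0 \<le> x \<and> x \<le> 1 \<and> x * real m \<in> \<int>"
    using assms by (auto simp: Luk_def)
next
  assume x: "0 \<le> x \<and> x \<le> 1 \<and> x * real m \<in> \<int>"
  then obtain z where z: "x * real m = of_int z" by (auto elim: Ints_cases)
  have "0 \<le> x * real m" "x * real m \<le> real m"
    using x assms by (simp_all add: mult_left_le_one_le)
  then have "0 \<le> z" "z \<le> int m" using z by linarith+
  then have "nat z \<le> m" "x = real (nat z) / real m"
    using z assms by (auto simp: field_simps)
  then show "x \<in> Luk m" by (auto simp: Luk_def)
qed

lemma finite_Luk: "finite (Luk m)"
  by (simp add: Luk_def)

lemma Luk_mono:
  assumes "m dvd q" "q > 0"
  shows "Luk m \<subseteq> Luk q"
proof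
  fix x assume x: "x \<in> Luk m"
  obtain d where d: "q = m * d" using assms by blast
  have m: "m > 0" using assms by (auto intro: Nat.gr0I)
  then have "x * real m \<in> \<int>" using x by (simp add: Luk_iff)
  then have "(x * real m) * real d \<in> \<int>" by (rule Ints_mult) (rule Ints_of_nat)
  then have "x * real q \<in> \<int>" by (simp add: d mult.assoc)
  then show "x \<in> Luk q"
    using x m assms by (simp add: Luk_iff)
qed

text \<open>By Bezout, \<open>x * gcd m q\<close> is an integer combination of \<open>x * m\<close>
  and \<open>x * q\<close>.\<close>

lemma Luk_gcd:
  assumes "m > 0" "q > 0"
  shows "Luk m \<inter> Luk q = Luk (gcd m q)"
proof
  show "Luk (gcd m q) \<subseteq> Luk m \<inter> Luk q"
    using Luk_mono assms by simp
next
  obtain a b where ab: "a * int m + b * int q = int (gcd m q)"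
    using bezout_int[of "int m" "int q"] by auto
  have eq: "x * real (gcd m q) = of_int a * (x * real m) + of_int b * (x * real q)" for x
  proof -
    have "real (gcd m q) = of_int a * real m + of_int b * real q"
      using arg_cong[OF ab, of real_of_int] by simp
    then show ?thesis by (simp add: algebra_simps)
  qed
  show "Luk m \<inter> Luk q \<subseteq> Luk (gcd m q)"
    using assms by (auto simp: Luk_iff eq)
qed

lemma Max_eq_1_iff:
  fixes f :: "nat \<Rightarrow> real"
  assumes "m \<ge> 1" "\<And>l. l < m \<Longrightarrow> f l \<le> 1"
  shows "Max {f l | l. l < m} = 1 \<longleftrightarrow> (\<exists>l<m. f l = 1)"
proof -
  have "finite {f l | l. l < m}" "{f l | l. l < m} \<noteq> {}"
    using assms(1) by (auto intro: exI[of _ 0])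
  then have "Max {f l | l. l < m} = 1 \<longleftrightarrow> 1 \<in> {f l | l. l < m} \<and> (\<forall>x\<in>{f l | l. l < m}. x \<le> 1)"
    by (rule Max_eq_iff)
  then show ?thesis using assms(2) by auto
qed

section \<open>The tight complex algebra of a frame\<close>

locale Ln_frame =
  fixes I :: "'i set" and k :: "'i \<Rightarrow> nat" and n :: nat and F :: "('i, 'w) frame"
  assumes n: "n \<ge> 1" and k: "\<forall>i\<in>I. k i \<ge> 1" and frame: "is_Ln_frame I k n F"
begin

abbreviation "W \<equiv> worlds F"
abbreviation "A \<equiv> tight_complex_algebra k n F"
abbreviation "homs \<equiv> mv_homs n A"
abbreviation "Ce \<equiv> canonical_extension k n F"

text \<open>The admissible \<open>m\<close> include \<open>n\<close> and are closed under gcd by the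
  frame axiom. The least of them hence divides all others, so the gcd is itself admissible.\<close>

lemma s_idx:
  assumes u: "u \<in> W"
  shows "s_idx n F u dvd n" "u \<in> rpred F (s_idx n F u)"
proof -
  define M where "M = {m. m dvd n \<and> u \<in> rpred F m}"
  have "n \<in> M" using u frame by (simp add: M_def is_Ln_frame_def)
  define m where "m = (LEAST m. m \<in> M)"
  have m: "m \<in> M" unfolding m_def using \<open>n \<in> M\<close> by (rule LeastI)
  have "m dvd q" if q: "q \<in> M" for q
  proof -
    have "gcd m q \<in> M"
      using m q frame unfolding M_def is_Ln_frame_def
      by (metis (no_types, lifting) IntI dvd_trans gcd_dvd1 mem_Collect_eq)
    then have "m \<le> gcd m q" unfolding m_def by (rule Least_le)
    moreover have "gcd m q \<le> m"
      using m n by (intro gcd_le1_nat) (auto simp: M_def)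
    ultimately show ?thesis by (metis gcd_dvd2 le_antisym)
  qed
  then have "Gcd M = m"
    using m by (intro dvd_antisym Gcd_dvd Gcd_greatest)
  then have "s_idx n F u \<in> M" using m by (simp add: s_idx_def M_def)
  then show "s_idx n F u dvd n" "u \<in> rpred F (s_idx n F u)"
    by (simp_all add: M_def)
qed

lemma s_idx_pos: "u \<in> W \<Longrightarrow> s_idx n F u > 0"
  using s_idx(1)[of u] n by (auto intro: Nat.gr0I)

lemma s_idx_dvd_iff:
  assumes "u \<in> W" "m dvd n"
  shows "s_idx n F u dvd m \<longleftrightarrow> u \<in> rpred F m"
proof
  assume "s_idx n F u dvd m"
  then have "gcd (s_idx n F u) m = s_idx n F u" by (simp add: gcd_nat.absorb1)
  moreover have "rpred F (s_idx n F u) \<inter> rpred F m = rpred F (gcd (s_idx n F u) m)"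
    using frame s_idx(1)[OF assms(1)] assms(2) unfolding is_Ln_frame_def by blast
  ultimately show "u \<in> rpred F m" using s_idx(2)[OF assms(1)] by auto
next
  assume "u \<in> rpred F m"
  then show "s_idx n F u dvd m"
    using assms unfolding s_idx_def by (intro Gcd_dvd) simp
qed

lemma rels_closed:
  assumes "i \<in> I" "m dvd n" "(u, vs) \<in> rels F i" "u \<in> rpred F m"
  shows "vs \<in> tuples (k i) (rpred F m)"
proof -
  have "rels F i `` {u} \<subseteq> tuples (k i) (rpred F m)"
    using frame assms(1,2,4) by (simp add: is_Ln_frame_def)
  then show ?thesis using assms(3) by auto
qed

lemma rels_worlds:
  assumes "i \<in> I" "(u, vs) \<in> rels F i"
  shows "u \<in> W" "vs \<in> tuples (k i) W"
proof -
  have "rels F i \<subseteq> W \<times> tuples (k i) W"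
    using frame assms(1) by (simp add: is_Ln_frame_def)
  then show "u \<in> W" "vs \<in> tuples (k i) W" using assms(2) by auto
qed

lemma rels_length: "i \<in> I \<Longrightarrow> (u, vs) \<in> rels F i \<Longrightarrow> length vs = k i"
  using rels_worlds(2)[of i u vs] by (simp add: tuples_def)

lemma univ_iff:
  "\<alpha> \<in> univ A \<longleftrightarrow> \<alpha> \<in> extensional W \<and> (\<forall>u\<in>W. \<alpha> u \<in> Luk (s_idx n F u))"
  by (auto simp: tight_complex_algebra_def PiE_def Pi_def)

lemma restrict_univ:
  "(\<And>u. u \<in> W \<Longrightarrow> f u \<in> Luk (s_idx n F u)) \<Longrightarrow> (\<lambda>u\<in>W. f u) \<in> univ A"
  by (simp add: univ_iff)

lemma univ_Luk_n: "\<alpha> \<in> univ A \<Longrightarrow> u \<in> W \<Longrightarrow> \<alpha> u \<in> Luk n"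
  using Luk_mono[OF s_idx(1), of u] n by (auto simp: univ_iff)

lemma one_eq: "one A = (\<lambda>u\<in>W. 1)"
  and neg_eq: "neg A \<alpha> = (\<lambda>u\<in>W. 1 - \<alpha> u)"
  and imp_eq: "imp A \<alpha> \<beta> = (\<lambda>u\<in>W. min 1 (1 - \<alpha> u + \<beta> u))"
  by (simp_all add: tight_complex_algebra_def)

lemma one_univ: "one A \<in> univ A"
  unfolding one_eq by (rule restrict_univ) (simp add: Luk_iff s_idx_pos)

lemma neg_univ: "\<alpha> \<in> univ A \<Longrightarrow> neg A \<alpha> \<in> univ A"
  unfolding neg_eq
  by (rule restrict_univ) (simp add: univ_iff Luk_iff s_idx_pos left_diff_distrib)

lemma imp_univ: "\<alpha> \<in> univ A \<Longrightarrow> \<beta> \<in> univ A \<Longrightarrow> imp A \<alpha> \<beta> \<in> univ A"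
  unfolding imp_eq
proof (rule restrict_univ)
  fix u assume *: "\<alpha> \<in> univ A" "\<beta> \<in> univ A" "u \<in> W"
  have "(1 - \<alpha> u + \<beta> u) * real (s_idx n F u) \<in> \<int>"
    using * by (simp add: univ_iff Luk_iff s_idx_pos left_diff_distrib distrib_right)
  then show "min 1 (1 - \<alpha> u + \<beta> u) \<in> Luk (s_idx n F u)"
    using * by (simp add: univ_iff Luk_iff s_idx_pos min_def)
qed

text \<open>0 and 1 lie in every chain, so every set of worlds has an indicator in the algebra,
  whatever the indices \<open>s_idx\<close>.\<close>

definition ind :: "'w set \<Rightarrow> 'w \<Rightarrow> real" where
  "ind B = (\<lambda>u\<in>W. if u \<in> B then 1 else 0)"

lemma ind_univ: "ind B \<in> univ A"
  unfolding ind_def by (rule restrict_univ) (simp add: Luk_iff s_idx_pos)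

text \<open>The frame condition puts successors of \<open>u\<close> into
  \<open>rpred F (s_idx n F u)\<close>, so their indices divide that of \<open>u\<close> and their
  chains are contained in its chain. This keeps \<open>nabla\<close> inside the product.\<close>

lemma nabla_Luk:
  assumes i: "i \<in> I" and as: "as \<in> tuples (k i) (univ A)" and R: "(u, vs) \<in> rels F i"
    and l: "l < k i"
  shows "(as ! l) (vs ! l) \<in> Luk (s_idx n F u)"
proof -
  have u: "u \<in> W" using rels_worlds[OF i R] by simp
  have "vs ! l \<in> rpred F (s_idx n F u)"
    using rels_closed[OF i s_idx(1)[OF u] R s_idx(2)[OF u]] l by (auto simp: tuples_def)
  moreover have W: "vs ! l \<in> W"
    using rels_worlds[OF i R] l by (auto simp: tuples_def)
  ultimately have "s_idx n F (vs ! l) dvd s_idx n F u"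
    using s_idx_dvd_iff s_idx(1)[OF u] by blast
  moreover have "as ! l \<in> univ A" using as l by (auto simp: tuples_def)
  ultimately show ?thesis
    using Luk_mono[of "s_idx n F (vs ! l)"] s_idx_pos[OF u] W by (auto simp: univ_iff)
qed

lemma nabla_le_1:
  assumes "i \<in> I" "as \<in> tuples (k i) (univ A)" "(u, vs) \<in> rels F i" "l < k i"
  shows "(as ! l) (vs ! l) \<le> 1"
  using nabla_Luk[OF assms] s_idx_pos rels_worlds[OF assms(1,3)] by (simp add: Luk_iff)

lemma nabla_Max_Luk:
  assumes i: "i \<in> I" and as: "as \<in> tuples (k i) (univ A)" and R: "(u, vs) \<in> rels F i"
  shows "Max {(as ! l) (vs ! l) | l. l < k i} \<in> Luk (s_idx n F u)"
proof -
  have "0 < k i" using k i by auto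
  then have "Max {(as ! l) (vs ! l) | l. l < k i} \<in> {(as ! l) (vs ! l) | l. l < k i}"
    by (intro Max_in) auto
  then show ?thesis using nabla_Luk[OF i as R] by auto
qed

lemma nabla_apply:
  assumes "u \<in> W"
  shows "nabla A i as u = (if rels F i `` {u} = {} then 1
         else Min {Max {(as ! l) (vs ! l) | l. l < k i} | vs. vs \<in> rels F i `` {u}})"
  using assms by (simp add: tight_complex_algebra_def)

lemma nabla_finite:
  assumes i: "i \<in> I" and as: "as \<in> tuples (k i) (univ A)"
  shows "finite {Max {(as ! l) (vs ! l) | l. l < k i} | vs. vs \<in> rels F i `` {u}}"
  by (rule finite_subset[OF _ finite_Luk[of "s_idx n F u"]]) (use nabla_Max_Luk[OF i as] in auto)

lemma nabla_univ:
  assumes i: "i \<in> I" and as: "as \<in> tuples (k i) (univ A)"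
  shows "nabla A i as \<in> univ A"
  unfolding univ_iff
proof (intro conjI ballI)
  show "nabla A i as \<in> extensional W" by (simp add: tight_complex_algebra_def)
  fix u assume u: "u \<in> W"
  show "nabla A i as u \<in> Luk (s_idx n F u)"
  proof (cases "rels F i `` {u} = {}")
    case True
    then show ?thesis using u s_idx_pos by (simp add: nabla_apply Luk_iff)
  next
    case False
    let ?M = "{Max {(as ! l) (vs ! l) | l. l < k i} | vs. vs \<in> rels F i `` {u}}"
    have "Min ?M \<in> ?M" using False by (intro Min_in nabla_finite[OF i as]) auto
    then have "Min ?M \<in> Luk (s_idx n F u)" using nabla_Max_Luk[OF i as] by auto
    then show ?thesis using False u by (simp add: nabla_apply)
  qed
qed

text \<open>The canonical relation tests \<open>nabla\<close> only for the value 1, the top of the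
  chain, where minimum and maximum become quantifiers. Finiteness of the chain ensures that the
  minimum is attained.\<close>

lemma nabla_eq_1_iff:
  assumes i: "i \<in> I" and as: "as \<in> tuples (k i) (univ A)" and u: "u \<in> W"
  shows "nabla A i as u = 1 \<longleftrightarrow> (\<forall>vs. (u, vs) \<in> rels F i \<longrightarrow> (\<exists>l<k i. (as ! l) (vs ! l) = 1))"
proof (cases "rels F i `` {u} = {}")
  case True
  then show ?thesis using u by (auto simp: nabla_apply)
next
  case False
  let ?m = "\<lambda>vs. Max {(as ! l) (vs ! l) | l. l < k i}"
  let ?M = "{?m vs | vs. vs \<in> rels F i `` {u}}"
  have M: "finite ?M" "?M \<noteq> {}" using nabla_finite[OF i as] False by auto
  have le: "x \<le> 1" if "x \<in> ?M" for x
  proof -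
    have "x \<in> Luk (s_idx n F u)" using that nabla_Max_Luk[OF i as] by auto
    then show ?thesis using s_idx_pos[OF u] by (simp add: Luk_iff)
  qed
  have eq: "?m vs = 1 \<longleftrightarrow> (\<exists>l<k i. (as ! l) (vs ! l) = 1)" if "(u, vs) \<in> rels F i" for vs
    using k i nabla_le_1[OF i as that] by (intro Max_eq_1_iff) auto
  have "Min ?M = 1 \<longleftrightarrow> (\<forall>x\<in>?M. x = 1)"
  proof
    assume 1: "Min ?M = 1"
    show "\<forall>x\<in>?M. x = 1"
    proof
      fix x assume x: "x \<in> ?M"
      show "x = 1" using Min_le[OF M(1) x] le[OF x] unfolding 1 by (rule antisym[rotated])
    qed
  next
    assume "\<forall>x\<in>?M. x = 1"
    then show "Min ?M = 1" using Min_in[OF M] by (rule bspec)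
  qed
  also have "\<dots> \<longleftrightarrow> (\<forall>vs. (u, vs) \<in> rels F i \<longrightarrow> ?m vs = 1)" by auto
  also have "\<dots> \<longleftrightarrow> (\<forall>vs. (u, vs) \<in> rels F i \<longrightarrow> (\<exists>l<k i. (as ! l) (vs ! l) = 1))"
    using eq by simp
  finally show ?thesis using False u by (simp add: nabla_apply)
qed

section \<open>MV-homomorphisms and the sets on which they concentrate\<close>

lemma hom_Luk: "h \<in> homs \<Longrightarrow> \<alpha> \<in> univ A \<Longrightarrow> h \<alpha> \<in> Luk n"
  by (auto simp: mv_homs_def)

lemma hom_bounds: "h \<in> homs \<Longrightarrow> \<alpha> \<in> univ A \<Longrightarrow> 0 \<le> h \<alpha> \<and> h \<alpha> \<le> 1"
  using hom_Luk[of h \<alpha>] n by (simp add: Luk_iff)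

lemma hom_one: "h \<in> homs \<Longrightarrow> h (one A) = 1"
  and hom_neg: "h \<in> homs \<Longrightarrow> \<alpha> \<in> univ A \<Longrightarrow> h (neg A \<alpha>) = 1 - h \<alpha>"
  and hom_imp: "h \<in> homs \<Longrightarrow> \<alpha> \<in> univ A \<Longrightarrow> \<beta> \<in> univ A \<Longrightarrow>
    h (imp A \<alpha> \<beta>) = min 1 (1 - h \<alpha> + h \<beta>)"
  by (auto simp: mv_homs_def)

lemma one_apply: "u \<in> W \<Longrightarrow> one A u = 1"
  and neg_apply: "u \<in> W \<Longrightarrow> neg A \<alpha> u = 1 - \<alpha> u"
  and imp_apply: "u \<in> W \<Longrightarrow> imp A \<alpha> \<beta> u = min 1 (1 - \<alpha> u + \<beta> u)"
  by (simp_all add: one_eq neg_eq imp_eq)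

lemma univ_eqI:
  assumes "\<alpha> \<in> univ A" "\<beta> \<in> univ A" "\<And>u. u \<in> W \<Longrightarrow> \<alpha> u = \<beta> u"
  shows "\<alpha> = \<beta>"
  using assms by (intro extensionalityI[of _ W]) (auto simp: univ_iff)

text \<open>The truncated sum and product are MV-terms, so homomorphisms respect them.\<close>

definition oplus where "oplus \<alpha> \<beta> = imp A (neg A \<alpha>) \<beta>"
definition otimes where "otimes \<alpha> \<beta> = neg A (imp A \<alpha> (neg A \<beta>))"

lemma oplus_univ: "\<alpha> \<in> univ A \<Longrightarrow> \<beta> \<in> univ A \<Longrightarrow> oplus \<alpha> \<beta> \<in> univ A"
  and otimes_univ: "\<alpha> \<in> univ A \<Longrightarrow> \<beta> \<in> univ A \<Longrightarrow> otimes \<alpha> \<beta> \<in> univ A"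
  by (simp_all add: oplus_def otimes_def imp_univ neg_univ)

lemma oplus_apply: "u \<in> W \<Longrightarrow> oplus \<alpha> \<beta> u = min 1 (\<alpha> u + \<beta> u)"
  and otimes_apply: "u \<in> W \<Longrightarrow> otimes \<alpha> \<beta> u = max 0 (\<alpha> u + \<beta> u - 1)"
  unfolding oplus_def otimes_def imp_apply neg_apply by (linarith, linarith)

lemma hom_oplus:
  assumes "h \<in> homs" "\<alpha> \<in> univ A" "\<beta> \<in> univ A"
  shows "h (oplus \<alpha> \<beta>) = min 1 (h \<alpha> + h \<beta>)"
  using assms by (simp add: oplus_def hom_imp[OF assms(1)] hom_neg[OF assms(1)] neg_univ)

lemma hom_otimes:
  assumes "h \<in> homs" "\<alpha> \<in> univ A" "\<beta> \<in> univ A"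
  shows "h (otimes \<alpha> \<beta>) = max 0 (h \<alpha> + h \<beta> - 1)"
proof -
  have "h (otimes \<alpha> \<beta>) = 1 - min 1 (1 - h \<alpha> + (1 - h \<beta>))"
    using assms by (simp add: otimes_def hom_imp[OF assms(1)] hom_neg[OF assms(1)] neg_univ imp_univ)
  then show ?thesis by linarith
qed

definition clamp :: "real \<Rightarrow> real" where "clamp x = max 0 (min 1 x)"

text \<open>This drives the induction on the slope. The factor \<open>clamp (t + 1)\<close> is 1 for
  \<open>t \<ge> 0\<close> and 0 for \<open>t \<le> -1\<close>; in between \<open>clamp t\<close>
  vanishes and the truncated product leaves \<open>max 0 (t + y)\<close>.\<close>

lemma clamp_add:
  assumes "0 \<le> y" "y \<le> 1"
  shows "clamp (t + y) = max 0 (min 1 (clamp t + y) + clamp (t + 1) - 1)"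
proof -
  consider "t \<ge> 0" | "t \<le> -1" | "-1 < t" "t < 0" by linarith
  then show ?thesis
    using assms by cases (simp_all add: clamp_def)
qed

text \<open>
  The easy half of McNaughton's theorem: truncated affine functions with integer coefficients are
  MV-terms, so they commute with homomorphisms.
\<close>

lemma hom_clamp:
  assumes h: "h \<in> homs" and \<alpha>: "\<alpha> \<in> univ A"
  shows "\<exists>\<beta>\<in>univ A. (\<forall>u\<in>W. \<beta> u = clamp (real m * \<alpha> u + of_int z)) \<and>
           h \<beta> = clamp (real m * h \<alpha> + of_int z)"
proof (induction m arbitrary: z)
  case 0
  show ?case
  proof (cases "z \<ge> 1")
    case True
    then have "clamp (of_int z) = 1" by (simp add: clamp_def)
    then show ?thesis
      by (intro bexI[of _ "one A"]) (simp_all add: one_univ one_apply hom_one[OF h])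
  next
    case False
    then have "clamp (of_int z) = 0" by (simp add: clamp_def)
    then show ?thesis
      by (intro bexI[of _ "neg A (one A)"])
        (simp_all add: one_univ one_apply hom_one[OF h] neg_univ neg_apply hom_neg[OF h one_univ])
  qed
next
  case (Suc m)
  obtain \<beta> where \<beta>: "\<beta> \<in> univ A" "\<And>u. u \<in> W \<Longrightarrow> \<beta> u = clamp (real m * \<alpha> u + of_int z)"
    "h \<beta> = clamp (real m * h \<alpha> + of_int z)" using Suc.IH by meson
  obtain \<gamma> where \<gamma>: "\<gamma> \<in> univ A" "\<And>u. u \<in> W \<Longrightarrow> \<gamma> u = clamp (real m * \<alpha> u + of_int (z + 1))"
    "h \<gamma> = clamp (real m * h \<alpha> + of_int (z + 1))" using Suc.IH by meson
  have step: "clamp (real (Suc m) * y + of_int z) =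
      max 0 (min 1 (clamp (real m * y + of_int z) + y) + clamp (real m * y + of_int (z + 1)) - 1)"
    if "0 \<le> y" "y \<le> 1" for y
    using clamp_add[OF that, of "real m * y + of_int z"] by (simp add: algebra_simps)
  have bounds: "0 \<le> \<alpha> u \<and> \<alpha> u \<le> 1" if "u \<in> W" for u
    using univ_Luk_n[OF \<alpha> that] n by (simp add: Luk_iff)
  show ?case
  proof (intro bexI[of _ "otimes (oplus \<beta> \<alpha>) \<gamma>"] conjI ballI)
    show "otimes (oplus \<beta> \<alpha>) \<gamma> \<in> univ A"
      using \<alpha> \<beta> \<gamma> by (intro otimes_univ oplus_univ)
    show "otimes (oplus \<beta> \<alpha>) \<gamma> u = clamp (real (Suc m) * \<alpha> u + of_int z)" if "u \<in> W" for u
      using step[of "\<alpha> u"] bounds[OF that] \<beta>(2)[OF that] \<gamma>(2)[OF that] that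
      by (simp add: otimes_apply oplus_apply)
    show "h (otimes (oplus \<beta> \<alpha>) \<gamma>) = clamp (real (Suc m) * h \<alpha> + of_int z)"
      using step[of "h \<alpha>"] hom_bounds[OF h \<alpha>] \<alpha> \<beta> \<gamma>
      by (simp add: hom_otimes[OF h] hom_oplus[OF h] oplus_univ)
  qed
qed

text \<open>On multiples of \<open>1 / n\<close>, the truncated difference of
  \<open>clamp (n x - i + 1)\<close> and \<open>clamp (n x - i)\<close> is 1 at
  \<open>x = i / n\<close> and 0 elsewhere. With \<open>h \<alpha> = i / n\<close> this writes the
  indicator of the level set as an MV-term in \<open>\<alpha>\<close>, which \<open>h\<close>
  evaluates to 1.\<close>

lemma hom_level:
  assumes h: "h \<in> homs" and \<alpha>: "\<alpha> \<in> univ A"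
  shows "h (ind {u \<in> W. \<alpha> u = h \<alpha>}) = 1"
proof -
  have npos: "real n > 0" using n by simp
  obtain i :: int where i: "real n * h \<alpha> = of_int i"
    using hom_Luk[OF h \<alpha>] n by (auto simp: Luk_iff mult.commute elim: Ints_cases)
  obtain \<beta> where \<beta>: "\<beta> \<in> univ A" "\<And>u. u \<in> W \<Longrightarrow> \<beta> u = clamp (real n * \<alpha> u + of_int (1 - i))"
    "h \<beta> = clamp (real n * h \<alpha> + of_int (1 - i))" using hom_clamp[OF h \<alpha>] by meson
  obtain \<gamma> where \<gamma>: "\<gamma> \<in> univ A" "\<And>u. u \<in> W \<Longrightarrow> \<gamma> u = clamp (real n * \<alpha> u + of_int (- i))"
    "h \<gamma> = clamp (real n * h \<alpha> + of_int (- i))" using hom_clamp[OF h \<alpha>] by meson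
  have "ind {u \<in> W. \<alpha> u = h \<alpha>} = otimes \<beta> (neg A \<gamma>)"
  proof (rule univ_eqI[OF ind_univ])
    show "otimes \<beta> (neg A \<gamma>) \<in> univ A" using \<beta> \<gamma> by (intro otimes_univ neg_univ)
    fix u assume u: "u \<in> W"
    obtain j :: int where j: "real n * \<alpha> u = of_int j"
      using univ_Luk_n[OF \<alpha> u] n by (auto simp: Luk_iff mult.commute elim: Ints_cases)
    have "\<alpha> u = h \<alpha> \<longleftrightarrow> real n * \<alpha> u = real n * h \<alpha>" using npos by simp
    then have "\<alpha> u = h \<alpha> \<longleftrightarrow> j = i" using i j by simp
    then have "ind {u \<in> W. \<alpha> u = h \<alpha>} u = (if j = i then 1 else 0)"
      using u by (simp add: ind_def)
    moreover have "otimes \<beta> (neg A \<gamma>) u = max 0 (clamp (of_int (j + (1 - i))) - clamp (of_int (j - i)))"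
      using u \<beta> \<gamma> j by (simp add: otimes_apply neg_apply)
    moreover consider "j = i" | "j \<ge> i + 1" | "j + 1 \<le> i" by linarith
    then have "max 0 (clamp (of_int (j + (1 - i))) - clamp (of_int (j - i))) = (if j = i then 1 else 0)"
      by cases (auto simp: clamp_def max_def min_def)
    ultimately show "ind {u \<in> W. \<alpha> u = h \<alpha>} u = otimes \<beta> (neg A \<gamma>) u" by simp
  qed
  then show ?thesis
    using \<beta> \<gamma> i by (simp add: hom_otimes[OF h] hom_neg[OF h] neg_univ clamp_def)
qed

text \<open>On indicators the Boolean operations are MV-terms. This and the next three facts are
  what is used of the ultrafilter of sets \<open>B\<close> with
  \<open>h (ind B) = 1\<close>.\<close>

lemma hom_ind_Int:
  assumes "h \<in> homs" "h (ind B) = 1" "h (ind C) = 1"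
  shows "h (ind (B \<inter> C)) = 1"
proof -
  have "ind (B \<inter> C) = otimes (ind B) (ind C)"
    by (rule univ_eqI) (auto simp: ind_univ otimes_univ otimes_apply, auto simp: ind_def)
  then show ?thesis using assms(2,3) by (simp add: hom_otimes[OF assms(1)] ind_univ)
qed

lemma hom_ind_Diff:
  assumes "h \<in> homs"
  shows "h (ind (W - B)) = 1 - h (ind B)"
proof -
  have "ind (W - B) = neg A (ind B)"
    by (rule univ_eqI) (auto simp: ind_univ neg_univ neg_apply, auto simp: ind_def)
  then show ?thesis by (simp add: hom_neg[OF assms] ind_univ)
qed

lemma hom_ind_worlds:
  assumes "h \<in> homs"
  shows "h (ind W) = 1"
proof -
  have "ind W = one A"
    by (rule univ_eqI) (auto simp: ind_univ one_univ one_apply, auto simp: ind_def)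
  then show ?thesis by (simp add: hom_one[OF assms])
qed

lemma hom_ind_nonempty:
  assumes "h \<in> homs" "h (ind B) = 1"
  shows "B \<noteq> {}"
  using hom_ind_Diff[OF assms(1), of "{}"] hom_ind_worlds[OF assms(1)] assms(2) by auto

end


section \<open>Ultrapowers\<close>

definition ulim :: "'j filter \<Rightarrow> ('j \<Rightarrow> 'a) \<Rightarrow> 'a" where
  "ulim U x = (THE c. eventually (\<lambda>j. x j = c) U)"

lemma ulim_eqI:
  assumes "U \<noteq> bot" "eventually (\<lambda>j. x j = c) U"
  shows "ulim U x = c"
  unfolding ulim_def
proof (rule the_equality[of "\<lambda>c. eventually (\<lambda>j. x j = c) U", OF assms(2)])
  fix c' assume "eventually (\<lambda>j. x j = c') U"
  with assms(2) have "eventually (\<lambda>j. c' = c) U" by eventually_elim simp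
  then show "c' = c" using assms(1) by simp
qed

text \<open>The values split the indices into finitely many pieces, one of which belongs to the
  ultrafilter.\<close>

lemma eventually_ulim:
  assumes U: "is_ultrafilter U" and S: "finite S" "\<And>j. x j \<in> S"
  shows "eventually (\<lambda>j. x j = ulim U x) U"
proof -
  have bot: "U \<noteq> bot" using U by (simp add: is_ultrafilter_def)
  have "\<exists>c\<in>S. eventually (\<lambda>j. x j = c) U"
  proof (rule ccontr)
    assume "\<not> ?thesis"
    then have "\<forall>c\<in>S. eventually (\<lambda>j. x j \<noteq> c) U"
      using U unfolding is_ultrafilter_def by blast
    then have "eventually (\<lambda>j. \<forall>c\<in>S. x j \<noteq> c) U"
      using S(1) by (simp add: eventually_ball_finite)
    then have "eventually (\<lambda>j. False) U" by (rule eventually_mono) (use S(2) in auto)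
    then show False using bot by simp
  qed
  then obtain c where c: "eventually (\<lambda>j. x j = c) U" by blast
  then show ?thesis unfolding ulim_eqI[OF bot c] .
qed

lemma eventually_ultrafilter_bex:
  assumes "is_ultrafilter U" "finite S" "eventually (\<lambda>j. \<exists>c\<in>S. P c j) U"
  shows "\<exists>c\<in>S. eventually (P c) U"
proof (rule ccontr)
  assume "\<not> ?thesis"
  then have "\<forall>c\<in>S. eventually (\<lambda>j. \<not> P c j) U"
    using assms(1) unfolding is_ultrafilter_def by blast
  then have "eventually (\<lambda>j. \<forall>c\<in>S. \<not> P c j) U"
    using assms(2) by (simp add: eventually_ball_finite)
  with assms(3) have "eventually (\<lambda>j. False) U" by eventually_elim auto
  then show False using assms(1) by (simp add: is_ultrafilter_def)
qed

section \<open>The ultrapower as a frame\<close>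

locale Ln_ultrapower = Ln_frame I k n F
  for I :: "'i set" and k :: "'i \<Rightarrow> nat" and n :: nat and F :: "('i, 'w) frame" +
  fixes U :: "'j filter"
  assumes U: "is_ultrafilter U"
    and saturated: "\<And>m X P. (\<And>j. X j \<subseteq> {xs :: 'w list. length xs = m}) \<Longrightarrow> satisfies_directed U X P"
begin

abbreviation "V \<equiv> (UNIV :: 'j set) \<rightarrow> W"
abbreviation "cls g \<equiv> ultra_eq U W `` {g}"
abbreviation "Up \<equiv> ultrapower U F"

lemma U_not_bot: "U \<noteq> bot"
  using U by (simp add: is_ultrafilter_def)

lemma cls_eq_iff:
  assumes "g \<in> V" "h \<in> V"
  shows "cls g = cls h \<longleftrightarrow> eventually (\<lambda>j. g j = h j) U"
proof
  assume "cls g = cls h"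
  moreover have "h \<in> cls h" using assms by (simp add: ultra_eq_def)
  ultimately show "eventually (\<lambda>j. g j = h j) U" by (auto simp: ultra_eq_def)
next
  assume ev: "eventually (\<lambda>j. g j = h j) U"
  have "eventually (\<lambda>j. g j = f j) U \<longleftrightarrow> eventually (\<lambda>j. h j = f j) U" for f
    by (rule eventually_cong[OF ev]) simp
  then show "cls g = cls h" using assms by (auto simp: ultra_eq_def)
qed

lemma worlds_Up: "worlds Up = cls ` V"
  by (auto simp: ultrapower_def Let_def quotient_def)

lemma cls_rpred_iff:
  assumes "g \<in> V"
  shows "cls g \<in> rpred Up m \<longleftrightarrow> eventually (\<lambda>j. g j \<in> rpred F m) U"
proof
  assume "cls g \<in> rpred Up m"
  then obtain g' where g': "g' \<in> V" "cls g = cls g'" "eventually (\<lambda>j. g' j \<in> rpred F m) U"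
    by (auto simp: ultrapower_def Let_def)
  then have "eventually (\<lambda>j. g j = g' j) U" using cls_eq_iff assms by blast
  with g'(3) show "eventually (\<lambda>j. g j \<in> rpred F m) U" by eventually_elim simp
next
  assume "eventually (\<lambda>j. g j \<in> rpred F m) U"
  then show "cls g \<in> rpred Up m" using assms by (auto simp: ultrapower_def Let_def)
qed

lemma rpred_Up_subset: "rpred Up m \<subseteq> cls ` V"
  by (auto simp: ultrapower_def Let_def)

text \<open>The representative of the first coordinate is prescribed, while those of the tuple stay
  existential: this is the form in which saturation delivers successors.\<close>

lemma cls_rels_iff:
  assumes "g \<in> V"
  shows "(cls g, vs) \<in> rels Up i \<longleftrightarrow>
    (\<exists>hs. set hs \<subseteq> V \<and> vs = map (\<lambda>h. cls h) hs \<and>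
          eventually (\<lambda>j. (g j, map (\<lambda>h. h j) hs) \<in> rels F i) U)"
proof
  assume "(cls g, vs) \<in> rels Up i"
  then obtain g' hs where g': "g' \<in> V" "cls g = cls g'" "set hs \<subseteq> V" "vs = map (\<lambda>h. cls h) hs"
    and ev: "eventually (\<lambda>j. (g' j, map (\<lambda>h. h j) hs) \<in> rels F i) U"
    by (auto simp: ultrapower_def Let_def)
  then have "eventually (\<lambda>j. g j = g' j) U" using cls_eq_iff assms by blast
  with ev have "eventually (\<lambda>j. (g j, map (\<lambda>h. h j) hs) \<in> rels F i) U" by eventually_elim simp
  then show "\<exists>hs. set hs \<subseteq> V \<and> vs = map (\<lambda>h. cls h) hs \<and>
          eventually (\<lambda>j. (g j, map (\<lambda>h. h j) hs) \<in> rels F i) U"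
    using g' by blast
next
  assume "\<exists>hs. set hs \<subseteq> V \<and> vs = map (\<lambda>h. cls h) hs \<and>
          eventually (\<lambda>j. (g j, map (\<lambda>h. h j) hs) \<in> rels F i) U"
  then show "(cls g, vs) \<in> rels Up i"
    using assms by (auto simp: ultrapower_def Let_def)
qed

lemma rels_Up_E:
  assumes "(u, vs) \<in> rels Up i"
  obtains g where "g \<in> V" "u = cls g"
  using assms by (auto simp: ultrapower_def Let_def)

lemma const_in_V: "w \<in> W \<Longrightarrow> (\<lambda>_. w) \<in> V"
  by simp

lemma ultrapower_frame: "is_Ln_frame I k n Up"
  unfolding is_Ln_frame_def
proof (intro conjI allI ballI impI)
  have "W \<noteq> {}" using frame by (simp add: is_Ln_frame_def)
  then show "worlds Up \<noteq> {}" unfolding worlds_Up by (auto dest: const_in_V)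
next
  fix i assume i: "i \<in> I"
  show "rels Up i \<subseteq> worlds Up \<times> tuples (k i) (worlds Up)"
  proof clarify
    fix u vs assume R: "(u, vs) \<in> rels Up i"
    then obtain g where g: "g \<in> V" "u = cls g" by (rule rels_Up_E)
    then obtain hs where hs: "set hs \<subseteq> V" "vs = map (\<lambda>h. cls h) hs"
      and ev: "eventually (\<lambda>j. (g j, map (\<lambda>h. h j) hs) \<in> rels F i) U"
      using R cls_rels_iff by blast
    from ev have "eventually (\<lambda>j. length hs = k i) U"
      by eventually_elim (drule rels_length[OF i], simp)
    then have "length hs = k i" using U_not_bot by simp
    then show "u \<in> worlds Up \<and> vs \<in> tuples (k i) (worlds Up)"
      using g hs by (auto simp: worlds_Up tuples_def)
  qed
next
  fix m assume "m dvd n"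
  show "rpred Up m \<subseteq> worlds Up" unfolding worlds_Up by (rule rpred_Up_subset)
next
  have "rpred F n = W" using frame by (simp add: is_Ln_frame_def)
  then have "cls g \<in> rpred Up n" if "g \<in> V" for g
    using that by (auto simp: cls_rpred_iff[OF that] Pi_def)
  then show "rpred Up n = worlds Up"
    using rpred_Up_subset by (auto simp: worlds_Up)
next
  fix m q assume mq: "m dvd n" "q dvd n"
  have eq: "rpred F m \<inter> rpred F q = rpred F (gcd m q)"
    using frame mq by (simp add: is_Ln_frame_def)
  have gcd_iff: "cls g \<in> rpred Up m \<inter> rpred Up q \<longleftrightarrow> cls g \<in> rpred Up (gcd m q)" if "g \<in> V" for g
    by (simp add: cls_rpred_iff[OF that] eventually_conj_iff eq[symmetric])
  show "rpred Up m \<inter> rpred Up q = rpred Up (gcd m q)"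
  proof (intro set_eqI iffI)
    fix u assume u: "u \<in> rpred Up m \<inter> rpred Up q"
    then obtain g where "g \<in> V" "u = cls g" using rpred_Up_subset by blast
    then show "u \<in> rpred Up (gcd m q)" using gcd_iff u by blast
  next
    fix u assume u: "u \<in> rpred Up (gcd m q)"
    then obtain g where "g \<in> V" "u = cls g" using rpred_Up_subset by blast
    then show "u \<in> rpred Up m \<inter> rpred Up q" using gcd_iff u by blast
  qed
next
  fix m u i assume m: "m dvd n" and u: "u \<in> rpred Up m" and i: "i \<in> I"
  show "rels Up i `` {u} \<subseteq> tuples (k i) (rpred Up m)"
  proof
    fix vs assume R: "vs \<in> rels Up i `` {u}"
    then obtain g where g: "g \<in> V" "u = cls g" by (auto elim: rels_Up_E)
    then obtain hs where hs: "set hs \<subseteq> V" "vs = map (\<lambda>h. cls h) hs"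
      and ev: "eventually (\<lambda>j. (g j, map (\<lambda>h. h j) hs) \<in> rels F i) U"
      using R cls_rels_iff[OF g(1)] by auto
    have "eventually (\<lambda>j. g j \<in> rpred F m) U" using u g cls_rpred_iff by blast
    with ev have tup: "eventually (\<lambda>j. map (\<lambda>h. h j) hs \<in> tuples (k i) (rpred F m)) U"
      by eventually_elim (rule rels_closed[OF i m])
    then have "eventually (\<lambda>j. length hs = k i) U"
      by eventually_elim (simp add: tuples_def)
    then have "length hs = k i" using U_not_bot by simp
    moreover have "cls h \<in> rpred Up m" if "h \<in> set hs" for h
    proof -
      have "eventually (\<lambda>j. h j \<in> rpred F m) U"
        using tup by eventually_elim (use that in \<open>auto simp: tuples_def\<close>)
      then show ?thesis using cls_rpred_iff hs(1) that by blast
    qed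
    ultimately show "vs \<in> tuples (k i) (rpred Up m)"
      using hs by (auto simp: tuples_def)
  qed
qed

section \<open>Evaluation along a function into the worlds, and its surjectivity\<close>

definition val :: "('j \<Rightarrow> 'w) \<Rightarrow> ('w \<Rightarrow> real) \<Rightarrow> real" where
  "val g = (\<lambda>\<alpha>\<in>univ A. ulim U (\<lambda>j. \<alpha> (g j)))"

lemma eventually_val:
  assumes g: "g \<in> V" and \<alpha>: "\<alpha> \<in> univ A"
  shows "eventually (\<lambda>j. \<alpha> (g j) = val g \<alpha>) U"
  using eventually_ulim[OF U finite_Luk[of n], of "\<lambda>j. \<alpha> (g j)"] univ_Luk_n[OF \<alpha>] g \<alpha>
  by (auto simp: val_def Pi_def)

lemma val_eqI:
  assumes "\<alpha> \<in> univ A" "eventually (\<lambda>j. \<alpha> (g j) = c) U"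
  shows "val g \<alpha> = c"
  using ulim_eqI[OF U_not_bot assms(2)] assms(1) by (simp add: val_def)

lemma val_hom:
  assumes g: "g \<in> V"
  shows "val g \<in> homs"
proof -
  have W: "g j \<in> W" for j using g by auto
  have "val g \<alpha> \<in> Luk n" if \<alpha>: "\<alpha> \<in> univ A" for \<alpha>
  proof -
    have "eventually (\<lambda>j. val g \<alpha> \<in> Luk n) U"
      using eventually_val[OF g \<alpha>] by eventually_elim (metis univ_Luk_n[OF \<alpha> W])
    then show ?thesis using U_not_bot by simp
  qed
  moreover have "val g \<in> extensional (univ A)" by (simp add: val_def)
  moreover have "val g (one A) = 1"
    by (rule val_eqI[OF one_univ]) (simp add: one_apply[OF W])
  moreover have "val g (neg A \<alpha>) = 1 - val g \<alpha>" if \<alpha>: "\<alpha> \<in> univ A" for \<alpha>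
    by (rule val_eqI[OF neg_univ[OF \<alpha>]])
      (use eventually_val[OF g \<alpha>] in eventually_elim, simp add: neg_apply[OF W])
  moreover have "val g (imp A \<alpha> \<beta>) = min 1 (1 - val g \<alpha> + val g \<beta>)"
    if \<alpha>: "\<alpha> \<in> univ A" and \<beta>: "\<beta> \<in> univ A" for \<alpha> \<beta>
    by (rule val_eqI[OF imp_univ[OF \<alpha> \<beta>]])
      (use eventually_val[OF g \<alpha>] eventually_val[OF g \<beta>] in eventually_elim, simp add: imp_apply[OF W])
  ultimately show ?thesis
    by (simp add: mv_homs_def PiE_def Pi_def)
qed

text \<open>By \<open>hom_level\<close> the level set of \<open>\<alpha>\<close> at height
  \<open>h \<alpha>\<close> is one of the sets \<open>B\<close>, so \<open>\<alpha> (g j)\<close>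
  equals \<open>h \<alpha>\<close> almost everywhere.\<close>

lemma val_eq_hom:
  assumes g: "g \<in> V" and h: "h \<in> homs"
    and ev: "\<And>B. B \<subseteq> W \<Longrightarrow> h (ind B) = 1 \<Longrightarrow> eventually (\<lambda>j. g j \<in> B) U"
  shows "val g = h"
proof (rule extensionalityI[of _ "univ A"])
  show "val g \<in> extensional (univ A)" by (simp add: val_def)
  show "h \<in> extensional (univ A)" using h by (simp add: mv_homs_def PiE_def)
  fix \<alpha> assume \<alpha>: "\<alpha> \<in> univ A"
  have "eventually (\<lambda>j. g j \<in> {u \<in> W. \<alpha> u = h \<alpha>}) U"
    using hom_level[OF h \<alpha>] by (intro ev) auto
  then show "val g \<alpha> = h \<alpha>"
    by (intro val_eqI[OF \<alpha>]) (auto elim: eventually_mono)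
qed

text \<open>Saturation, applied to the filter base of boxes with sides in the ultrafilters of the \<open>vs ! l\<close>.\<close>

lemma realize_homs:
  fixes X :: "'j \<Rightarrow> 'w list set"
  assumes X: "\<And>j. X j \<subseteq> tuples m W" and vs: "vs \<in> tuples m homs"
    and ev: "\<And>B. (\<And>l. l < m \<Longrightarrow> B l \<subseteq> W \<and> (vs ! l) (ind (B l)) = 1) \<Longrightarrow>
               eventually (\<lambda>j. \<exists>xs\<in>X j. \<forall>l<m. xs ! l \<in> B l) U"
  shows "\<exists>hs. set hs \<subseteq> V \<and> map val hs = vs \<and> eventually (\<lambda>j. map (\<lambda>h. h j) hs \<in> X j) U"
proof -
  define D where "D = {B :: nat \<Rightarrow> 'w set. \<forall>l<m. B l \<subseteq> W \<and> (vs ! l) (ind (B l)) = 1}"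
  define Box where "Box B = {xs :: 'w list. \<forall>l<m. xs ! l \<in> B l}" for B
  have hom: "vs ! l \<in> homs" if "l < m" for l
    using vs that by (auto simp: tuples_def)
  have WD: "(\<lambda>_. W) \<in> D" using hom by (simp add: D_def hom_ind_worlds)
  have Box_Int: "Box B \<inter> Box B' = Box (\<lambda>l. B l \<inter> B' l)" for B B'
    by (auto simp: Box_def)
  have D_Int: "(\<lambda>l. B l \<inter> B' l) \<in> D" if "B \<in> D" "B' \<in> D" for B B'
    using that hom by (auto simp: D_def hom_ind_Int)
  have "satisfies_directed U X (Box ` D)"
    using X by (intro saturated[of _ m]) (auto simp: tuples_def)
  moreover have "Box ` D \<noteq> {}" "\<forall>B\<in>Box ` D. \<forall>B'\<in>Box ` D. B \<inter> B' \<in> Box ` D"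
    using WD D_Int by (auto simp: Box_Int)
  \<comment> \<open>The hypothesis \<open>ev\<close> excludes the null alternative of the
    requirement, which leaves a solution \<open>h\<close>.\<close>
  moreover have "\<not> (\<exists>B\<in>Box ` D. eventually (\<lambda>j. X j \<inter> B = {}) U)"
  proof clarify
    fix B assume B: "B \<in> D" and no: "eventually (\<lambda>j. X j \<inter> Box B = {}) U"
    have "eventually (\<lambda>j. \<exists>xs\<in>X j. \<forall>l<m. xs ! l \<in> B l) U"
      using B by (intro ev) (simp add: D_def)
    with no have "eventually (\<lambda>j. False) U"
      by eventually_elim (auto simp: Box_def)
    then show False using U_not_bot by simp
  qed
  ultimately obtain h where h: "\<And>B. B \<in> D \<Longrightarrow> eventually (\<lambda>j. h j \<in> X j \<inter> Box B) U"
    unfolding satisfies_directed_def by blast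
  obtain w where w: "w \<in> W" using frame by (auto simp: is_Ln_frame_def)
  \<comment> \<open>The default \<open>w\<close> is used only where \<open>h j\<close> falls outside
    \<open>X j\<close>, a null set of indices; it keeps \<open>g l\<close> in
    \<open>V\<close>.\<close>
  define g where "g l j = (if h j \<in> X j then h j ! l else w)" for l j
  define hs where "hs = map g [0..<m]"
  have gV: "g l \<in> V" if "l < m" for l
    using that w X by (fastforce simp: g_def tuples_def)
  have "val (g l) = vs ! l" if l: "l < m" for l
  proof (rule val_eq_hom[OF gV[OF l] hom[OF l]])
    fix B assume "B \<subseteq> W" "(vs ! l) (ind B) = 1"
    \<comment> \<open>A box that constrains side \<open>l\<close> alone isolates the
      \<open>l\<close>-th coordinate.\<close>
    then have "(\<lambda>_. W)(l := B) \<in> D" using WD by (simp add: D_def)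
    from h[OF this] show "eventually (\<lambda>j. g l j \<in> B) U"
      by eventually_elim (use l in \<open>auto simp: g_def Box_def\<close>)
  qed
  then have "map val hs = vs"
    using vs by (auto simp: hs_def tuples_def intro: nth_equalityI)
  moreover have "eventually (\<lambda>j. map (\<lambda>h. h j) hs \<in> X j) U"
    using h[OF WD]
  proof eventually_elim
    fix j assume "h j \<in> X j \<inter> Box (\<lambda>_. W)"
    then have "length (h j) = m" "h j \<in> X j" using X by (auto simp: tuples_def)
    then have "map (\<lambda>h. h j) hs = h j"
      by (auto simp: hs_def g_def intro: nth_equalityI)
    then show "map (\<lambda>h. h j) hs \<in> X j" using \<open>h j \<in> X j\<close> by simp
  qed
  moreover have "set hs \<subseteq> V" unfolding hs_def set_map set_upt by (intro image_subsetI gV) simp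
  ultimately show ?thesis by blast
qed

text \<open>Realisation of a one-element tuple with all worlds as candidates. It succeeds because no
  set in the ultrafilter of \<open>h\<close> is empty.\<close>

lemma val_surj:
  assumes h: "h \<in> homs"
  shows "\<exists>g\<in>V. val g = h"
proof -
  have "\<exists>hs. set hs \<subseteq> V \<and> map val hs = [h] \<and> eventually (\<lambda>j. map (\<lambda>h. h j) hs \<in> tuples 1 W) U"
  proof (rule realize_homs)
    show "[h] \<in> tuples 1 homs" using h by (simp add: tuples_def)
    fix B assume B: "\<And>l. l < 1 \<Longrightarrow> B l \<subseteq> W \<and> ([h] ! l) (ind (B l)) = 1"
    then obtain w where "w \<in> B 0" using hom_ind_nonempty[OF h, of "B 0"] by auto
    then have "[w] \<in> tuples 1 W \<and> (\<forall>l<1. [w] ! l \<in> B l)"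
      using B[of 0] by (auto simp: tuples_def)
    then show "eventually (\<lambda>j. \<exists>xs\<in>tuples 1 W. \<forall>l<1. xs ! l \<in> B l) U"
      by (intro always_eventually) blast
  qed simp
  then show ?thesis by auto
qed

section \<open>The canonical extension seen through evaluation\<close>

lemma worlds_Ce: "worlds Ce = homs"
  and rpred_Ce: "rpred Ce m = {h \<in> homs. h ` univ A \<subseteq> Luk m}"
  by (simp_all add: canonical_extension_def canonical_frame_def)

lemma rels_Ce_iff:
  assumes i: "i \<in> I"
  shows "(u, vs) \<in> rels Ce i \<longleftrightarrow> u \<in> homs \<and> vs \<in> tuples (k i) homs \<and>
    (\<forall>as\<in>tuples (k i) (univ A). u (nabla A i as) = 1 \<longrightarrow> (\<exists>l<k i. (vs ! l) (as ! l) = 1))"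
proof -
  have "Max {(vs ! l) (as ! l) | l. l < k i} = 1 \<longleftrightarrow> (\<exists>l<k i. (vs ! l) (as ! l) = 1)"
    if "vs \<in> tuples (k i) homs" "as \<in> tuples (k i) (univ A)" for as
  proof (rule Max_eq_1_iff)
    show "k i \<ge> 1" using k i by blast
    fix l assume "l < k i"
    then have "vs ! l \<in> homs" "as ! l \<in> univ A" using that by (auto simp: tuples_def)
    then show "(vs ! l) (as ! l) \<le> 1" using hom_bounds by blast
  qed
  then show ?thesis
    by (auto simp: canonical_extension_def canonical_frame_def)
qed

text \<open>From right to left this is preservation of the predicates; from left to right it pulls
  membership in \<open>rpred Ce m\<close> back to \<open>F\<close>, where the frame condition is
  available.\<close>

lemma val_rpred_iff:
  assumes g: "g \<in> V" and m: "m dvd n"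
  shows "val g \<in> rpred Ce m \<longleftrightarrow> eventually (\<lambda>j. g j \<in> rpred F m) U"
proof
  have W: "g j \<in> W" for j using g by auto
  have mpos: "m > 0" using m n by (auto intro: Nat.gr0I)
  {
    assume val: "val g \<in> rpred Ce m"
    define \<alpha> where "\<alpha> = (\<lambda>u\<in>W. 1 / real (s_idx n F u))"
    have \<alpha>: "\<alpha> \<in> univ A"
      unfolding \<alpha>_def by (rule restrict_univ) (simp add: Luk_iff s_idx_pos Suc_leI)
    then have L: "val g \<alpha> \<in> Luk m" using val by (auto simp: rpred_Ce)
    show "eventually (\<lambda>j. g j \<in> rpred F m) U"
      using eventually_val[OF g \<alpha>]
    proof eventually_elim
      fix j assume eq: "\<alpha> (g j) = val g \<alpha>"
      let ?s = "s_idx n F (g j)"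
      have "1 / real ?s * real m \<in> \<int>"
        using L[folded eq] mpos W[of j] by (simp add: \<alpha>_def Luk_iff)
      then obtain z where "real m / real ?s = of_int z" by (auto elim: Ints_cases)
      then have "real m = of_int z * real ?s" using s_idx_pos[OF W[of j]] by (simp add: field_simps)
      then have "int m = z * int ?s" by (metis of_int_eq_iff of_int_mult of_int_of_nat_eq)
      then have "?s dvd m" by (metis dvd_triv_right of_nat_dvd_iff)
      then show "g j \<in> rpred F m" using s_idx_dvd_iff[OF W m] by blast
    qed
  }
  {
    assume ev: "eventually (\<lambda>j. g j \<in> rpred F m) U"
    have "val g \<alpha> \<in> Luk m" if \<alpha>: "\<alpha> \<in> univ A" for \<alpha>
    proof -
      have "eventually (\<lambda>j. val g \<alpha> \<in> Luk m) U"
        using ev eventually_val[OF g \<alpha>]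
      proof eventually_elim
        fix j assume "g j \<in> rpred F m" "\<alpha> (g j) = val g \<alpha>"
        then show "val g \<alpha> \<in> Luk m"
          using \<alpha> W[of j] Luk_mono[of "s_idx n F (g j)" m] mpos s_idx_dvd_iff[OF W m]
          by (metis subsetD univ_iff)
      qed
      then show ?thesis using U_not_bot by simp
    qed
    then show "val g \<in> rpred Ce m" using val_hom[OF g] by (auto simp: rpred_Ce)
  }
qed

text \<open>At almost every \<open>j\<close> some coordinate has value 1. There are finitely many
  coordinates, so the ultrafilter selects one that works for almost all \<open>j\<close>.\<close>

lemma val_rels_forth:
  assumes i: "i \<in> I" and g: "g \<in> V" and hs: "set hs \<subseteq> V"
    and ev: "eventually (\<lambda>j. (g j, map (\<lambda>h. h j) hs) \<in> rels F i) U"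
  shows "(val g, map val hs) \<in> rels Ce i"
  unfolding rels_Ce_iff[OF i]
proof (intro conjI ballI impI)
  show "val g \<in> homs" using val_hom[OF g] .
  from ev have "eventually (\<lambda>j. length hs = k i) U"
    by eventually_elim (drule rels_length[OF i], simp)
  then have len: "length hs = k i" using U_not_bot by simp
  then show "map val hs \<in> tuples (k i) homs"
    using hs val_hom by (auto simp: tuples_def)
  fix as assume as: "as \<in> tuples (k i) (univ A)" and 1: "val g (nabla A i as) = 1"
  have "eventually (\<lambda>j. \<exists>l\<in>{..<k i}. (as ! l) ((hs ! l) j) = 1) U"
    using ev eventually_val[OF g nabla_univ[OF i as]]
  proof eventually_elim
    fix j assume R: "(g j, map (\<lambda>h. h j) hs) \<in> rels F i"
      and "nabla A i as (g j) = val g (nabla A i as)"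
    then have "nabla A i as (g j) = 1" using 1 by simp
    then obtain l where "l < k i" "(as ! l) (map (\<lambda>h. h j) hs ! l) = 1"
      using nabla_eq_1_iff[OF i as] R rels_worlds[OF i R] by blast
    then show "\<exists>l\<in>{..<k i}. (as ! l) ((hs ! l) j) = 1" using len by auto
  qed
  from eventually_ultrafilter_bex[OF U finite_lessThan this]
  obtain l where l: "l < k i" "eventually (\<lambda>j. (as ! l) ((hs ! l) j) = 1) U" by blast
  have "as ! l \<in> univ A" using as l by (auto simp: tuples_def)
  then have "val (hs ! l) (as ! l) = 1" using l(2) by (rule val_eqI)
  then show "\<exists>l<k i. (map val hs ! l) (as ! l) = 1" using l(1) len by auto
qed

text \<open>Saturation with the successor tuples of \<open>g j\<close> as candidates; here all
  coordinates must be found together.\<close>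

lemma val_rels_back:
  assumes i: "i \<in> I" and g: "g \<in> V" and R: "(val g, vs) \<in> rels Ce i"
  shows "\<exists>hs. set hs \<subseteq> V \<and> map val hs = vs \<and>
           eventually (\<lambda>j. (g j, map (\<lambda>h. h j) hs) \<in> rels F i) U"
proof -
  have W: "g j \<in> W" for j using g by auto
  have vs: "vs \<in> tuples (k i) homs" using R rels_Ce_iff[OF i] by blast
  have "\<exists>hs. set hs \<subseteq> V \<and> map val hs = vs \<and>
           eventually (\<lambda>j. map (\<lambda>h. h j) hs \<in> rels F i `` {g j}) U"
  proof (rule realize_homs[OF _ vs])
    show "rels F i `` {g j} \<subseteq> tuples (k i) W" for j using rels_worlds[OF i] by auto
    fix B assume B: "\<And>l. l < k i \<Longrightarrow> B l \<subseteq> W \<and> (vs ! l) (ind (B l)) = 1"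
    \<comment> \<open>If \<open>nabla A i as\<close> were 1 at a world, every successor tuple would
      leave the box in some coordinate. But each \<open>vs ! l\<close> sends \<open>as ! l\<close>
      to 0, so the canonical relation forbids the value 1 under \<open>val g\<close>, and almost
      every \<open>g j\<close> has a successor tuple inside the box.\<close>
    define as where "as = map (\<lambda>l. ind (W - B l)) [0..<k i]"
    have as: "as \<in> tuples (k i) (univ A)" by (auto simp: as_def tuples_def ind_univ)
    have "(vs ! l) (as ! l) = 0" if "l < k i" for l
    proof -
      have "vs ! l \<in> homs" using vs that by (auto simp: tuples_def)
      from hom_ind_Diff[OF this, of "B l"] show ?thesis using B[OF that] that by (simp add: as_def)
    qed
    then have "val g (nabla A i as) \<noteq> 1" using R as rels_Ce_iff[OF i] by fastforce
    then have "eventually (\<lambda>j. nabla A i as (g j) \<noteq> 1) U"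
      using eventually_val[OF g nabla_univ[OF i as]] by (auto elim: eventually_mono)
    then show "eventually (\<lambda>j. \<exists>xs\<in>rels F i `` {g j}. \<forall>l<k i. xs ! l \<in> B l) U"
    proof eventually_elim
      fix j assume "nabla A i as (g j) \<noteq> 1"
      then obtain xs where xs: "(g j, xs) \<in> rels F i" "\<And>l. l < k i \<Longrightarrow> (as ! l) (xs ! l) \<noteq> 1"
        using nabla_eq_1_iff[OF i as W] by blast
      have "xs ! l \<in> B l" if l: "l < k i" for l
      proof -
        have "xs ! l \<in> W" using rels_worlds(2)[OF i xs(1)] l by (auto simp: tuples_def)
        then show ?thesis using xs(2)[OF l] l by (auto simp: as_def ind_def split: if_splits)
      qed
      then show "\<exists>xs\<in>rels F i `` {g j}. \<forall>l<k i. xs ! l \<in> B l" using xs(1) by blast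
    qed
  qed
  then show ?thesis by simp
qed

text \<open>Closure of \<open>rpred Ce m\<close> under successors is inherited from
  \<open>F\<close>: a point and its successor tuple lift to functions into \<open>W\<close>, for
  which the condition holds almost everywhere.\<close>

lemma canonical_extension_frame: "is_Ln_frame I k n Ce"
  unfolding is_Ln_frame_def
proof (intro conjI allI ballI impI)
  obtain w where "w \<in> W" using frame by (auto simp: is_Ln_frame_def)
  then show "worlds Ce \<noteq> {}" unfolding worlds_Ce using val_hom[OF const_in_V] by blast
next
  fix i assume "i \<in> I"
  then show "rels Ce i \<subseteq> worlds Ce \<times> tuples (k i) (worlds Ce)"
    using rels_Ce_iff by (auto simp: worlds_Ce)
next
  show "rpred Ce n = worlds Ce" by (auto simp: rpred_Ce worlds_Ce hom_Luk)
next
  fix m assume "m dvd n"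
  show "rpred Ce m \<subseteq> worlds Ce" by (auto simp: rpred_Ce worlds_Ce)
next
  fix m q assume "m dvd n" "q dvd n"
  then have "m > 0" "q > 0" using n by (auto intro: Nat.gr0I)
  then have "Luk m \<inter> Luk q = Luk (gcd m q)" by (rule Luk_gcd)
  then show "rpred Ce m \<inter> rpred Ce q = rpred Ce (gcd m q)"
    unfolding rpred_Ce by blast
next
  fix m u i assume m: "m dvd n" and u: "u \<in> rpred Ce m" and i: "i \<in> I"
  show "rels Ce i `` {u} \<subseteq> tuples (k i) (rpred Ce m)"
  proof
    fix vs assume R: "vs \<in> rels Ce i `` {u}"
    have "u \<in> homs" using u by (simp add: rpred_Ce)
    then obtain g where g: "g \<in> V" "val g = u" using val_surj by blast
    obtain hs where hs: "set hs \<subseteq> V" "map val hs = vs"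
      and ev: "eventually (\<lambda>j. (g j, map (\<lambda>h. h j) hs) \<in> rels F i) U"
      using val_rels_back[OF i g(1), of vs] R g(2) by auto
    have "eventually (\<lambda>j. g j \<in> rpred F m) U" using val_rpred_iff[OF g(1) m] g(2) u by blast
    with ev have tup: "eventually (\<lambda>j. map (\<lambda>h. h j) hs \<in> tuples (k i) (rpred F m)) U"
      by eventually_elim (rule rels_closed[OF i m])
    have "val h \<in> rpred Ce m" if "h \<in> set hs" for h
    proof -
      have "eventually (\<lambda>j. h j \<in> rpred F m) U"
        using tup by eventually_elim (use that in \<open>auto simp: tuples_def\<close>)
      then show ?thesis using val_rpred_iff[OF _ m] hs(1) that by blast
    qed
    moreover have "length vs = k i" using R rels_Ce_iff[OF i] by (auto simp: tuples_def)
    ultimately show "vs \<in> tuples (k i) (rpred Ce m)"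
      using hs(2) by (auto simp: tuples_def)
  qed
qed

section \<open>The bounded morphism onto the canonical extension\<close>

definition \<phi> :: "('j \<Rightarrow> 'w) set \<Rightarrow> ('w \<Rightarrow> real) \<Rightarrow> real" where
  "\<phi> C = val (SOME g. g \<in> C)"

text \<open>Representatives that agree almost everywhere have the same limits, so the choice made in
  \<open>\<phi>\<close> is harmless.\<close>

lemma \<phi>_cls:
  assumes g: "g \<in> V"
  shows "\<phi> (cls g) = val g"
proof -
  define g' where "g' = (SOME g'. g' \<in> cls g)"
  have "g \<in> cls g" using g by (simp add: ultra_eq_def)
  then have "g' \<in> cls g" unfolding g'_def by (rule someI[of "\<lambda>g'. g' \<in> cls g"])
  then have g': "g' \<in> V" "eventually (\<lambda>j. g j = g' j) U" by (simp_all add: ultra_eq_def)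
  have "val g' \<alpha> = val g \<alpha>" for \<alpha>
  proof (cases "\<alpha> \<in> univ A")
    case True
    show ?thesis
      by (rule val_eqI[OF True])
        (use g'(2) eventually_val[OF g True] in eventually_elim, simp)
  qed (simp add: val_def)
  then have "val g' = val g" ..
  then show ?thesis by (simp only: \<phi>_def g'_def)
qed

lemma \<phi>_image: "\<phi> ` worlds Up = worlds Ce"
proof -
  have "\<phi> ` worlds Up = val ` V"
    unfolding worlds_Up image_image by (intro image_cong refl \<phi>_cls)
  also have "\<dots> = homs" using val_hom val_surj by blast
  finally show ?thesis by (simp add: worlds_Ce)
qed

lemma \<phi>_bounded_morphism: "Ln_bounded_morphism I k n Up Ce \<phi>"
  unfolding Ln_bounded_morphism_def
proof (intro conjI ballI allI impI ultrapower_frame canonical_extension_frame)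
  show "\<phi> \<in> worlds Up \<rightarrow> worlds Ce" using \<phi>_image by auto
next
  fix u i assume u: "u \<in> worlds Up" and i: "i \<in> I"
  obtain g where g: "g \<in> V" "u = cls g" using u by (auto simp: worlds_Up)
  have map_\<phi>: "map \<phi> (map (\<lambda>h. cls h) hs) = map val hs" if "set hs \<subseteq> V" for hs
    using that \<phi>_cls by auto
  show "map \<phi> ` (rels Up i `` {u}) = rels Ce i `` {\<phi> u}"
  proof (intro set_eqI iffI)
    fix vs assume "vs \<in> map \<phi> ` (rels Up i `` {u})"
    then obtain vs' where vs': "(cls g, vs') \<in> rels Up i" "vs = map \<phi> vs'"
      using g(2) by auto
    then obtain hs where hs: "set hs \<subseteq> V" "vs' = map (\<lambda>h. cls h) hs"
      "eventually (\<lambda>j. (g j, map (\<lambda>h. h j) hs) \<in> rels F i) U"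
      using cls_rels_iff[OF g(1)] by blast
    then show "vs \<in> rels Ce i `` {\<phi> u}"
      using val_rels_forth[OF i g(1) hs(1,3)] vs'(2) map_\<phi>[OF hs(1)] \<phi>_cls[OF g(1)] g(2)
      by (simp only: Image_singleton_iff)
  next
    fix vs assume "vs \<in> rels Ce i `` {\<phi> u}"
    then have "(val g, vs) \<in> rels Ce i" using \<phi>_cls[OF g(1)] g(2) by simp
    from val_rels_back[OF i g(1) this] obtain hs where hs: "set hs \<subseteq> V" "map val hs = vs"
      "eventually (\<lambda>j. (g j, map (\<lambda>h. h j) hs) \<in> rels F i) U" by blast
    then have "map (\<lambda>h. cls h) hs \<in> rels Up i `` {u}"
      using cls_rels_iff[OF g(1)] g(2) by blast
    then show "vs \<in> map \<phi> ` (rels Up i `` {u})"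
      using hs(2) map_\<phi>[OF hs(1)] by (metis image_eqI)
  qed
next
  fix m assume m: "m dvd n"
  show "\<phi> ` rpred Up m \<subseteq> rpred Ce m"
  proof clarify
    fix u assume u: "u \<in> rpred Up m"
    then obtain g where g: "g \<in> V" "u = cls g" using rpred_Up_subset by blast
    then show "\<phi> u \<in> rpred Ce m"
      using u cls_rpred_iff val_rpred_iff[OF g(1) m] \<phi>_cls by simp
  qed
qed

end

theorem theorem4p4:
  fixes I :: "'i set" and k :: "'i \<Rightarrow> nat" and n :: nat and F :: "('i, 'w) frame"
  assumes "n \<ge> 1"
    and "\<forall>i\<in>I. k i \<ge> 1"
    and "is_Ln_frame I k n F"
  shows "\<exists>U :: 'w set filter. is_ultrafilter U \<and>
           Ln_bounded_morphic_image I k n (canonical_extension k n F) (ultrapower U F)"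
\<comment> \<open>The ultrafilter lives on the power set of the type of worlds and is obtained
  without reference to \<open>F\<close>, so one ultrafilter serves all frames over that
  type.\<close>
proof (rule saturated_ultrafilter[where 'w = 'w])
  fix U :: "'w set filter"
  assume U: "is_ultrafilter U"
    "\<And>m X P. (\<And>j. X j \<subseteq> {xs :: 'w list. length xs = m}) \<Longrightarrow> satisfies_directed U X P"
  interpret Ln_ultrapower I k n F U
    by (unfold_locales; (rule assms U)?; assumption?)
  show ?thesis
    unfolding Ln_bounded_morphic_image_def
    using U(1) \<phi>_bounded_morphism \<phi>_image by (intro exI[of _ U] exI[of _ \<phi>] conjI)
qed

end
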